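(* Let $n\ge 1$ be an integer, $0\le\alpha<2$ and $0\le\beta<n/2$. Let $(u_0,u_1)\in\dot H^{-\beta}(\mathbb R^n)\times\dot H^{-\beta}(\mathbb R^n)$ be (real-valued) functions satisfying, for some constant $c>0$, $$u_0(x)+u_1(x)\ \ge\ c\,\langle x\rangle^{-n\left(\frac12+\frac{\beta}{n}\right)}\big(\log(e+|x|)\big)^{-1},\qquad x\in\mathbb R^n,$$ and assume that $$1<p<p_{\rm c}(\alpha,\beta,n):=1+\frac{4-2\alpha}{n+2\beta}.$$ Then there exist constants $\varepsilon_2>0$ and $C>0$ (independent of $\varepsilon$) such that for any $\varepsilon\in(0,\varepsilon_2]$ the lifespan $T_{\alpha,\beta}(\varepsilon)$ of solutions to $$\begin{cases}u_{tt}-\Delta u+u_t=|x|^{-\alpha}|u|^p, & x\in\mathbb R^n,\ t>0,\\ u(0,x)=\varepsilon u_0(x),\quad u_t(0,x)=\varepsilon u_1(x), & x\in\mathbb R^n,\end{cases}$$ satisfies $$T_{\alpha,\beta}(\varepsilon)\ \le\ C\,\varepsilon^{-\frac{4(p-1)}{4-2\alpha-(n+2\beta)(p-1)}}\big(\log(\varepsilon^{-1})\big)^{\frac{4(p-1)}{4-2\alpha-(n+2\beta)(p-1)}}.$$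
   Context: $\langle x\rangle:=\sqrt{1+|x|^2}$. The space $\dot H^{-\beta}$ consists of $\varphi\in\mathcal Z'=\mathcal S'/\mathcal P$ (tempered distributions modulo polynomials) with $\|\varphi\|_{\dot H^{-\beta}}:=\|\mathfrak F^{-1}(|\xi|^{-\beta}\widehat\varphi(\xi))\|_{L^2}<\infty$. Weak solutions: let $p>1$, $\alpha\ge0$, $T\in(0,\infty]$. A function $u\in\mathcal C([0,T),L^2)$ is a weak solution on $[0,T)$ (local if $T<\infty$, global if $T=\infty$) if for every $\phi(t,x)=\eta(t)\varphi(x)$ with $\eta\in\mathcal C_0^\infty([0,T))$ and $\varphi\in\mathcal C^\infty(\mathbb R^n)$ having all derivatives in $L^1\cap L^\infty$, $$\int_0^T\!\!\int_{\mathbb R^n}|x|^{-\alpha}|u|^p\phi\,dx\,dt=\int_0^T\!\!\int_{\mathbb R^n}(\partial_t^2-\Delta+\partial_t)u\;\phi\,dx\,dt,$$ where the right-hand side is understood after integration by parts using the initial conditions, i.e. (with the integrals well defined) $$\int_0^T\!\!\int_{\mathbb R^n}|x|^{-\alpha}|u|^p\phi\,dx\,dt+\varepsilon\int_{\mathbb R^n}(u_0+u_1)(x)\,\phi(0,x)\,dx-\varepsilon\int_{\mathbb R^n}u_0(x)\,\partial_t\phi(0,x)\,dx=\int_0^T\!\!\int_{\mathbb R^n}u\,(\partial_t^2-\Delta-\partial_t)\phi\,dx\,dt.$$ Lifespan: $T_{\alpha,\beta}(\varepsilon):=\sup\{T\in(0,\infty):$ there exists a unique local weak solution $u$ on $[0,T)$,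 that is, a unique $u\in\mathcal C([0,T),L^2)$ such that $\int_0^T\int_{\mathbb R^n}|x|^{-\alpha}|u|^p\phi\,dx\,dt+\varepsilon\int_{\mathbb R^n}(u_0+u_1)(x)\,\phi(0,x)\,dx-\varepsilon\int_{\mathbb R^n}u_0(x)\,\partial_t\phi(0,x)\,dx=\int_0^T\int_{\mathbb R^n}u\,(\partial_t^2-\Delta-\partial_t)\phi\,dx\,dt$ (with the integrals well defined) for every $\phi(t,x)=\eta(t)\varphi(x)$ with $\eta\in\mathcal C_0^\infty([0,T))$ and $\varphi\in\mathcal C^\infty(\mathbb R^n)$ having all derivatives in $L^1\cap L^\infty$, with the fixed parameter $\varepsilon>0\}$. *)

theory Defs
  imports "HOL-Analysis.Analysis"
begin

definition partial_deriv :: "'a::euclidean_space \<Rightarrow> ('a \<Rightarrow> 'b::real_normed_vector) \<Rightarrow> 'a \<Rightarrow> 'b"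
  where "partial_deriv b f x = frechet_derivative f (at x) b"

primrec partial_derivs ::
    "'a::euclidean_space list \<Rightarrow> ('a \<Rightarrow> 'b::real_normed_vector) \<Rightarrow> 'a \<Rightarrow> 'b"
  where
    "partial_derivs [] f = f"
  | "partial_derivs (b # bs) f = partial_deriv b (partial_derivs bs f)"

text \<open>Multi-indices are represented by lists of elements of \<open>Basis\<close>. Differentiability of
  all iterated partial derivatives includes their continuity, so this is the class of
  infinitely often continuously differentiable functions.\<close>

definition smooth :: "('a::euclidean_space \<Rightarrow> 'b::real_normed_vector) \<Rightarrow> bool"
  where "smooth f \<longleftrightarrow>
    (\<forall>bs. set bs \<subseteq> Basis \<longrightarrow> (\<forall>x. partial_derivs bs f differentiable (at x)))"

definition laplacian :: "('a::euclidean_space \<Rightarrow> 'b::real_normed_vector) \<Rightarrow> 'a \<Rightarrow> 'b"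
  where "laplacian f x = (\<Sum>b\<in>Basis. partial_derivs [b, b] f x)"

definition smooth_compact_support :: "('a::euclidean_space \<Rightarrow> 'b::real_normed_vector) \<Rightarrow> bool"
  where "smooth_compact_support f \<longleftrightarrow> smooth f \<and> compact (closure {x. f x \<noteq> 0})"

definition square_integrable :: "('a::euclidean_space \<Rightarrow> 'b::euclidean_space) \<Rightarrow> bool"
  where "square_integrable f \<longleftrightarrow>
    f \<in> borel_measurable lborel \<and> integrable lborel (\<lambda>x. (norm (f x))\<^sup>2)"

definition norm_L2 :: "('a::euclidean_space \<Rightarrow> 'b::euclidean_space) \<Rightarrow> real"
  where "norm_L2 f = sqrt (LINT x|lborel. (norm (f x))\<^sup>2)"

text \<open>The space \<open>C([0,T), L\<^sup>2)\<close>. Elements of \<open>L\<^sup>2\<close> are represented by functions, and every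
  continuous curve in \<open>L\<^sup>2\<close> has a representative that is jointly measurable in time and
  space; space-time integrals below refer to such a representative.\<close>

definition continuous_L2_curve :: "real \<Rightarrow> (real \<Rightarrow> 'a::euclidean_space \<Rightarrow> real) \<Rightarrow> bool"
  where "continuous_L2_curve T u \<longleftrightarrow>
    (\<lambda>(t, x). u t x) \<in> borel_measurable (restrict_space borel ({0..<T} \<times> UNIV)) \<and>
    (\<forall>t\<in>{0..<T}. square_integrable (u t)) \<and>
    (\<forall>t\<in>{0..<T}. ((\<lambda>s. norm_L2 (\<lambda>x. u s x - u t x)) \<longlongrightarrow> 0) (at t within {0..<T}))"

definition schwartz :: "('a::euclidean_space \<Rightarrow> complex) set"
  where "schwartz = {\<psi>. smooth \<psi> \<and>
    (\<forall>k bs. set bs \<subseteq> Basis \<longrightarrow>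
      bounded (range (\<lambda>x. (1 + norm x) ^ k *\<^sub>R partial_derivs bs \<psi> x)))}"

definition schwartz_seminorm :: "nat \<Rightarrow> ('a::euclidean_space \<Rightarrow> complex) \<Rightarrow> real"
  where "schwartz_seminorm N \<psi> =
    (SUP (bs, x) \<in> {bs. set bs \<subseteq> Basis \<and> length bs \<le> N} \<times> UNIV.
      (1 + norm x) ^ N * norm (partial_derivs bs \<psi> x))"

text \<open>Continuous complex-linear functionals on \<open>schwartz\<close>; values outside \<open>schwartz\<close> are
  irrelevant.\<close>

definition tempered_distribution :: "(('a::euclidean_space \<Rightarrow> complex) \<Rightarrow> complex) \<Rightarrow> bool"
  where "tempered_distribution \<Phi> \<longleftrightarrow>
    (\<forall>\<psi>\<in>schwartz. \<forall>\<theta>\<in>schwartz. \<Phi> (\<lambda>x. \<psi> x + \<theta> x) = \<Phi> \<psi> + \<Phi> \<theta>) \<and>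
    (\<forall>a. \<forall>\<psi>\<in>schwartz. \<Phi> (\<lambda>x. a * \<psi> x) = a * \<Phi> \<psi>) \<and>
    (\<exists>C N. \<forall>\<psi>\<in>schwartz. norm (\<Phi> \<psi>) \<le> C * schwartz_seminorm N \<psi>)"

definition fourier :: "('a::euclidean_space \<Rightarrow> complex) \<Rightarrow> 'a \<Rightarrow> complex"
  where "fourier \<psi> \<xi> = complex_of_real ((2 * pi) powr (- real DIM('a) / 2)) *
    (LINT x|lborel. cis (- (x \<bullet> \<xi>)) * \<psi> x)"

definition inv_fourier :: "('a::euclidean_space \<Rightarrow> complex) \<Rightarrow> 'a \<Rightarrow> complex"
  where "inv_fourier \<psi> x = complex_of_real ((2 * pi) powr (- real DIM('a) / 2)) *
    (LINT \<xi>|lborel. cis (x \<bullet> \<xi>) * \<psi> \<xi>)"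

definition fourier_distr ::
    "(('a::euclidean_space \<Rightarrow> complex) \<Rightarrow> complex) \<Rightarrow> ('a \<Rightarrow> complex) \<Rightarrow> complex"
  where "fourier_distr \<Phi> \<psi> = \<Phi> (fourier \<psi>)"

text \<open>The Schwartz functions all of whose moments vanish. A tempered distribution vanishes on
  this space iff it is a polynomial, so the restriction of tempered distributions to it
  identifies \<open>S'/P\<close> with its dual \<open>Z'\<close>.\<close>

definition zero_moment_schwartz :: "('a::euclidean_space \<Rightarrow> complex) set"
  where "zero_moment_schwartz = {\<theta> \<in> schwartz. \<forall>\<gamma> :: 'a \<Rightarrow> nat.
    (LINT x|lborel. complex_of_real (\<Prod>b\<in>Basis. (x \<bullet> b) ^ \<gamma> b) * \<theta> x) = 0}"

text \<open>The element \<open>F\<^sup>-\<^sup>1(|\<xi>|\<^sup>-\<^sup>\<beta> F\<Phi>)\<close> of \<open>Z'\<close>, to be evaluated on \<open>zero_moment_schwartz\<close> only: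
  the multiplier and the inverse Fourier transform are moved to the test function. The
  inverse Fourier transform of a test function vanishes to infinite order at the origin, so
  that its product with the singular multiplier is again in \<open>schwartz\<close>.\<close>

definition riesz_distr ::
    "real \<Rightarrow> (('a::euclidean_space \<Rightarrow> complex) \<Rightarrow> complex) \<Rightarrow> ('a \<Rightarrow> complex) \<Rightarrow> complex"
  where "riesz_distr \<beta> \<Phi> \<theta> =
    fourier_distr \<Phi> (\<lambda>\<xi>. complex_of_real (norm \<xi> powr (- \<beta>)) * inv_fourier \<theta> \<xi>)"

text \<open>The \<open>L\<^sup>2\<close> norm of an element of \<open>Z'\<close>: infinite unless the functional is given by an
  \<open>L\<^sup>2\<close> function \<open>g\<close>, which is then unique up to null sets.\<close>

definition norm_L2_distr :: "(('a::euclidean_space \<Rightarrow> complex) \<Rightarrow> complex) \<Rightarrow> ennreal"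
  where "norm_L2_distr W =
    (INF g \<in> {g. square_integrable g \<and>
        (\<forall>\<theta>\<in>zero_moment_schwartz. W \<theta> = (LINT x|lborel. g x * \<theta> x))}.
      ennreal (norm_L2 g))"

definition neg_hom_sobolev_norm ::
    "real \<Rightarrow> (('a::euclidean_space \<Rightarrow> complex) \<Rightarrow> complex) \<Rightarrow> ennreal"
  where "neg_hom_sobolev_norm \<beta> \<Phi> = norm_L2_distr (riesz_distr \<beta> \<Phi>)"

definition represents_distr ::
    "('a::euclidean_space \<Rightarrow> real) \<Rightarrow> (('a \<Rightarrow> complex) \<Rightarrow> complex) \<Rightarrow> bool"
  where "represents_distr f \<Phi> \<longleftrightarrow>
    (\<forall>K. compact K \<longrightarrow> set_integrable lborel K f) \<and>
    (\<forall>\<psi>. smooth_compact_support \<psi> \<longrightarrow>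
      \<Phi> \<psi> = (LINT x|lborel. complex_of_real (f x) * \<psi> x))"

text \<open>Real-valued, locally integrable functions that are tempered distributions and whose class
  modulo polynomials belongs to the homogeneous Sobolev space of order \<open>-\<beta>\<close>.\<close>

definition neg_hom_sobolev :: "real \<Rightarrow> ('a::euclidean_space \<Rightarrow> real) set"
  where "neg_hom_sobolev \<beta> = {f. \<exists>\<Phi>. tempered_distribution \<Phi> \<and> represents_distr f \<Phi> \<and>
    neg_hom_sobolev_norm \<beta> \<Phi> < \<infinity>}"

text \<open>\<open>C\<^sub>0\<^sup>\<infinity>([0,T))\<close>: smooth up to \<open>t = 0\<close>, where they need not vanish, with compact support in
  \<open>[0,T)\<close>. Such functions are the restrictions to \<open>[0,T)\<close> of the following ones; only the values
  on \<open>[0,T)\<close> are used.\<close>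

definition time_test_function :: "real \<Rightarrow> (real \<Rightarrow> real) \<Rightarrow> bool"
  where "time_test_function T \<eta> \<longleftrightarrow> smooth \<eta> \<and> (\<exists>\<tau><T. \<forall>t\<ge>\<tau>. \<eta> t = 0)"

text \<open>Derivatives are continuous here, so being essentially bounded means being bounded.\<close>

definition space_test_function :: "('a::euclidean_space \<Rightarrow> real) \<Rightarrow> bool"
  where "space_test_function \<phi> \<longleftrightarrow> smooth \<phi> \<and>
    (\<forall>bs. set bs \<subseteq> Basis \<longrightarrow>
      integrable lborel (partial_derivs bs \<phi>) \<and> bounded (range (partial_derivs bs \<phi>)))"

definition weak_identity ::
    "real \<Rightarrow> real \<Rightarrow> ('a::euclidean_space \<Rightarrow> real) \<Rightarrow> ('a \<Rightarrow> real) \<Rightarrow> real \<Rightarrow> real \<Rightarrow>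
     (real \<Rightarrow> 'a \<Rightarrow> real) \<Rightarrow> (real \<Rightarrow> real) \<Rightarrow> ('a \<Rightarrow> real) \<Rightarrow> bool"
  where "weak_identity \<alpha> p u0 u1 \<epsilon> T u \<eta> \<phi> \<longleftrightarrow>
    (let Q = {0..<T} \<times> UNIV;
         source = (\<lambda>(t, x). norm x powr (- \<alpha>) * \<bar>u t x\<bar> powr p * (\<eta> t * \<phi> x));
         init0 = (\<lambda>x. (u0 x + u1 x) * (\<eta> 0 * \<phi> x));
         init1 = (\<lambda>x. u0 x * (deriv \<eta> 0 * \<phi> x));
         linear_part = (\<lambda>(t, x). u t x *
           (deriv (deriv \<eta>) t * \<phi> x - \<eta> t * laplacian \<phi> x - deriv \<eta> t * \<phi> x))
     in set_integrable lborel Q source \<and> integrable lborel init0 \<and> integrable lborel init1 \<and>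
        set_integrable lborel Q linear_part \<and>
        (LINT z:Q|lborel. source z) + \<epsilon> * (LINT x|lborel. init0 x)
            - \<epsilon> * (LINT x|lborel. init1 x)
          = (LINT z:Q|lborel. linear_part z))"

definition weak_solution ::
    "real \<Rightarrow> real \<Rightarrow> ('a::euclidean_space \<Rightarrow> real) \<Rightarrow> ('a \<Rightarrow> real) \<Rightarrow> real \<Rightarrow> real \<Rightarrow>
     (real \<Rightarrow> 'a \<Rightarrow> real) \<Rightarrow> bool"
  where "weak_solution \<alpha> p u0 u1 \<epsilon> T u \<longleftrightarrow> continuous_L2_curve T u \<and>
    (\<forall>\<eta> \<phi>. time_test_function T \<eta> \<longrightarrow> space_test_function \<phi> \<longrightarrow>
      weak_identity \<alpha> p u0 u1 \<epsilon> T u \<eta> \<phi>)"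

text \<open>Uniqueness is in \<open>C([0,T), L\<^sup>2)\<close>, hence up to null sets at each time.\<close>

definition unique_weak_solution_exists ::
    "real \<Rightarrow> real \<Rightarrow> ('a::euclidean_space \<Rightarrow> real) \<Rightarrow> ('a \<Rightarrow> real) \<Rightarrow> real \<Rightarrow> real \<Rightarrow> bool"
  where "unique_weak_solution_exists \<alpha> p u0 u1 \<epsilon> T \<longleftrightarrow>
    (\<exists>u. weak_solution \<alpha> p u0 u1 \<epsilon> T u) \<and>
    (\<forall>u v. weak_solution \<alpha> p u0 u1 \<epsilon> T u \<longrightarrow> weak_solution \<alpha> p u0 u1 \<epsilon> T v \<longrightarrow>
      (\<forall>t\<in>{0..<T}. AE x in lborel. u t x = v t x))"

text \<open>The supremum is taken in \<open>[0,\<infinity>]\<close>. The order \<open>\<beta>\<close> of the Sobolev space containing the data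
  enters the lifespan only through the data.\<close>

definition lifespan ::
    "real \<Rightarrow> real \<Rightarrow> ('a::euclidean_space \<Rightarrow> real) \<Rightarrow> ('a \<Rightarrow> real) \<Rightarrow> real \<Rightarrow> ennreal"
  where "lifespan \<alpha> p u0 u1 \<epsilon> =
    (SUP T \<in> {T. 0 < T \<and> unique_weak_solution_exists \<alpha> p u0 u1 \<epsilon> T}. ennreal T)"

definition p_crit :: "real \<Rightarrow> real \<Rightarrow> nat \<Rightarrow> real"
  where "p_crit \<alpha> \<beta> n = 1 + (4 - 2 * \<alpha>) / (real n + 2 * \<beta>)"

definition japanese_bracket :: "'a::real_normed_vector \<Rightarrow> real"
  where "japanese_bracket x = sqrt (1 + (norm x)\<^sup>2)"

end

theory Submission
  imports Defs "HOL-Computational_Algebra.Polynomial" "HOL-Probability.Distributions"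
begin

text \<open>The weak identity is tested with \<open>\<eta>(t) = exp (-1 / (1 - (t/\<tau>)\<^sup>2))\<close> and
  \<open>\<phi>(x) = exp (-|x|\<^sup>2 / R\<^sup>2)\<close>, where \<open>\<tau> = R\<^sup>2 < T\<close>. Since \<open>\<eta>'(0) = 0\<close>, the only datum that
  enters is \<open>u\<^sub>0 + u\<^sub>1\<close>. The derivatives of \<open>\<eta>\<close> and \<open>\<phi>\<close> are \<open>\<eta>\<close> and \<open>\<phi>\<close> times factors
  \<open>G\<close> of size \<open>1/\<tau>\<close> whose growth \<open>\<eta>\<close> and \<open>\<phi>\<close> absorb. Hence Young's inequality with the
  weight \<open>\<eta>\<phi>\<close> bounds \<open>|u| G\<close> by the nonlinear term plus an explicit remainder, the nonlinear
  terms cancel, and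
  \<open>\<epsilon> \<integral> (u\<^sub>0 + u\<^sub>1) \<phi> \<le> M R powr (n + (\<alpha> - 2)/(p - 1))\<close>. By the lower bound on the data the left
  side is at least a multiple of \<open>\<epsilon> R powr (n/2 - \<beta>) / log (e + R)\<close>. Subcriticality makes the
  resulting power of \<open>R\<close> positive, which bounds \<open>R\<close> and therefore \<open>T\<close>.\<close>

subsection \<open>A smooth cutoff in time\<close>

lemma partial_deriv_eq:
  assumes "(f has_derivative f') (at x)"
  shows "partial_deriv b f x = f' b"
  using frechet_derivative_at[OF assms] by (simp add: partial_deriv_def)

lemma partial_derivs_in_class:
  assumes "f \<in> S" and "\<And>g b. g \<in> S \<Longrightarrow> b \<in> Basis \<Longrightarrow> partial_deriv b g \<in> S"
    and "set bs \<subseteq> Basis"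
  shows "partial_derivs bs f \<in> S"
  using assms(3) by (induction bs) (auto intro: assms(1,2))

text \<open>Membership in a class closed under partial derivatives passes to all iterated
  derivatives, so no formula for derivatives of arbitrary order is required. The classes used are
  rescaled \<open>bump\<close> functions and polynomials times a fixed Gaussian.\<close>

lemma smooth_if_in_class:
  assumes "f \<in> S" and "\<And>g x. g \<in> S \<Longrightarrow> g differentiable (at x)"
    and "\<And>g b. g \<in> S \<Longrightarrow> b \<in> Basis \<Longrightarrow> partial_deriv b g \<in> S"
  shows "smooth f"
  unfolding smooth_def using partial_derivs_in_class[OF assms(1,3)] assms(2) by blast

text \<open>Raise \<open>z / m \<le> exp (z / m)\<close> to the power \<open>m\<close>. In this form
  the exponential absorbs powers, both at the end of the time interval and at spatial
  infinity.\<close>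

lemma powr_mult_exp_minus_le:
  fixes z m :: real
  assumes "0 \<le> z" "0 < m"
  shows "z powr m * exp (- z) \<le> m powr m"
proof -
  have "z / m \<le> exp (z / m)"
    using exp_ge_add_one_self[of "z / m"] by linarith
  then have "(z / m) powr m \<le> exp (z / m) powr m"
    using assms by (intro powr_mono2) auto
  also have "exp (z / m) powr m = exp z"
    using assms by (simp add: powr_def)
  finally have "z powr m / m powr m \<le> exp z"
    using assms by (simp add: powr_divide)
  then have "z powr m \<le> m powr m * exp z"
    using assms by (simp add: divide_simps mult.commute)
  then show ?thesis
    by (simp add: exp_minus divide_simps)
qed

text \<open>The cutoff proper is \<open>bump 0 1\<close>. The free polynomial and the free pole
  order make the family closed under differentiation.\<close>

definition bump :: "nat \<Rightarrow> real poly \<Rightarrow> real \<Rightarrow> real"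
  where "bump k q s = (if \<bar>s\<bar> < 1 then poly q s / (1 - s\<^sup>2) ^ k * exp (- 1 / (1 - s\<^sup>2)) else 0)"

text \<open>This is the numerator of the derivative over \<open>(1 - s^2) ^ (k + 2)\<close>; the
  polynomial \<open>[:1, 0, -1:]\<close> is 1 - s^2. The three terms come from differentiating the
  polynomial, the negative power and the exponential.\<close>

definition bump_step :: "nat \<Rightarrow> real poly \<Rightarrow> real poly"
  where "bump_step k q = pderiv q * [:1, 0, -1:] ^ 2 + [:0, 2 * real k:] * q * [:1, 0, -1:] - [:0, 2:] * q"

lemma poly_bump_step:
  "poly (bump_step k q) s
    = poly (pderiv q) s * (1 - s\<^sup>2)\<^sup>2 + 2 * real k * s * poly q s * (1 - s\<^sup>2) - 2 * s * poly q s"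
  by (simp add: bump_step_def power2_eq_square algebra_simps)

lemma one_minus_square_pos: "\<bar>s\<bar> < 1 \<Longrightarrow> 0 < 1 - s\<^sup>2" for s :: real
  by (simp add: abs_square_less_1)

lemma poly_bounded_unit_interval:
  fixes q :: "real poly"
  obtains M where "0 \<le> M" "\<And>s. \<bar>s\<bar> < 1 \<Longrightarrow> \<bar>poly q s\<bar> \<le> M"
proof -
  have "bounded (poly q ` {-1..1})"
    by (intro compact_imp_bounded compact_continuous_image continuous_intros) auto
  then obtain M where "\<forall>y\<in>poly q ` {-1..1}. \<bar>y\<bar> \<le> M"
    by (auto simp: bounded_iff)
  then show thesis
    by (intro that[of "max 0 M"]) (fastforce simp: le_max_iff_disj)+
qed

text \<open>The exponential absorbs the pole of order \<open>k\<close> together with two further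
  powers of 1 - s^2. The resulting quadratic decay at the boundary makes the extension by zero
  differentiable there.\<close>

lemma bump_bound:
  obtains M where "0 \<le> M" "\<And>s. \<bar>bump k q s\<bar> \<le> (if \<bar>s\<bar> < 1 then M * (1 - s\<^sup>2)\<^sup>2 else 0)"
proof -
  obtain M where M: "0 \<le> M" "\<And>s. \<bar>s\<bar> < 1 \<Longrightarrow> \<bar>poly q s\<bar> \<le> M"
    using poly_bounded_unit_interval[of q] by blast
  define K where "K = (real k + 2) powr (real k + 2)"
  have "\<bar>bump k q s\<bar> \<le> M * K * (1 - s\<^sup>2)\<^sup>2" if s: "\<bar>s\<bar> < 1" for s
  proof -
    define v where "v = 1 - s\<^sup>2"
    have v: "0 < v" using one_minus_square_pos[OF s] by (simp add: v_def)
    have "(1 / v) powr (real k + 2) * exp (- (1 / v)) \<le> K"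
      unfolding K_def using v by (intro powr_mult_exp_minus_le) auto
    also have "(1 / v) powr (real k + 2) = 1 / v ^ (k + 2)"
      using v powr_realpow[of "1 / v" "k + 2"] by (simp add: power_one_over add.commute)
    finally have *: "1 / v ^ k * exp (- 1 / v) \<le> K * v\<^sup>2"
      using v by (simp add: field_simps power_add power2_eq_square)
    have "\<bar>bump k q s\<bar> = \<bar>poly q s\<bar> * (1 / v ^ k * exp (- 1 / v))"
      using s v by (simp add: bump_def v_def abs_mult)
    also have "\<dots> \<le> M * (K * v\<^sup>2)"
      using M(1) v by (intro mult_mono[OF M(2)[OF s] *]) auto
    finally show ?thesis by (simp add: v_def)
  qed
  moreover have "0 \<le> M * K" using M by (simp add: K_def)
  ultimately show thesis by (intro that[of "M * K"]) (auto simp: bump_def)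
qed

lemma bump_has_derivative_interior:
  assumes s: "\<bar>s\<bar> < 1"
  shows "(bump k q has_real_derivative bump (k + 2) (bump_step k q) s) (at s)"
proof -
  define i where "i s = inverse (1 - s\<^sup>2)" for s :: real
  define g where "g s = poly q s * i s ^ k * exp (- i s)" for s
  define v where "v = 1 - s\<^sup>2"
  have v: "0 < v" using one_minus_square_pos[OF s] by (simp add: v_def)
  have i: "i s = inverse v" by (simp add: i_def v_def)
  have "(i has_real_derivative - (inverse v * (- 2 * s) * inverse v)) (at s)"
    unfolding i_def v_def
    by (rule DERIV_inverse') (use v in \<open>auto simp: v_def intro!: derivative_eq_intros\<close>)
  then have di: "(i has_real_derivative 2 * s * (inverse v)\<^sup>2) (at s)"
    by (simp add: power2_eq_square mult.assoc mult.left_commute)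
  have dpow: "((\<lambda>s. i s ^ k) has_real_derivative real k * (2 * s) * (inverse v) ^ (k + 1)) (at s)"
  proof (cases k)
    case (Suc j)
    with DERIV_power_Suc[OF di, of j] show ?thesis
      by (simp add: i power2_eq_square algebra_simps)
  qed simp
  have dexp: "((\<lambda>s. exp (- i s)) has_real_derivative
      exp (- inverse v) * (- (2 * s) * (inverse v)\<^sup>2)) (at s)"
    using i by (auto intro!: derivative_eq_intros di)
  have "(g has_real_derivative
    (poly (pderiv q) s * inverse (v ^ k)
      + poly q s * (real k * (2 * s) * (inverse v) ^ (k + 1))) * exp (- inverse v)
      + poly q s * inverse (v ^ k) * (exp (- inverse v) * (- (2 * s) * (inverse v)\<^sup>2))) (at s)"
    unfolding g_def using DERIV_mult[OF DERIV_mult[OF poly_DERIV dpow] dexp]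
    by (simp add: i power_inverse algebra_simps)
  also have "(poly (pderiv q) s * inverse (v ^ k)
      + poly q s * (real k * (2 * s) * (inverse v) ^ (k + 1))) * exp (- inverse v)
      + poly q s * inverse (v ^ k) * (exp (- inverse v) * (- (2 * s) * (inverse v)\<^sup>2))
      = bump (k + 2) (bump_step k q) s"
  proof -
    have "bump (k + 2) (bump_step k q) s =
      (poly (pderiv q) s * v\<^sup>2 + 2 * real k * s * poly q s * v - 2 * s * poly q s) / v ^ (k + 2)
        * exp (- inverse v)"
      using s by (simp add: bump_def poly_bump_step v_def[symmetric] inverse_eq_divide)
    \<comment> \<open>With \<open>u\<close> for the inverse of \<open>v\<close> and \<open>w\<close>
      for its k-th power, clearing denominators becomes a polynomial identity modulo
      \<open>v * u = 1\<close> in which \<open>k\<close> no longer occurs as an exponent.\<close>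
    moreover have "(P * w + p * (m * (2 * s) * (w * u))) * E + p * w * (E * (- (2 * s) * u\<^sup>2))
        = (P * v\<^sup>2 + 2 * m * s * p * v - 2 * s * p) * (w * u\<^sup>2) * E"
      if "v * u = 1" for P p m w u E :: real
      using that by algebra
    from this[of "inverse v" "poly (pderiv q) s" "inverse (v ^ k)" "poly q s" "real k" "exp (- inverse v)"]
    have "(poly (pderiv q) s * inverse (v ^ k)
        + poly q s * (real k * (2 * s) * (inverse v) ^ (k + 1))) * exp (- inverse v)
        + poly q s * inverse (v ^ k) * (exp (- inverse v) * (- (2 * s) * (inverse v)\<^sup>2))
      = (poly (pderiv q) s * v\<^sup>2 + 2 * real k * s * poly q s * v - 2 * s * poly q s)
        * (inverse (v ^ k) * (inverse v)\<^sup>2) * exp (- inverse v)"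
      using v by (simp add: power_inverse mult.commute)
    moreover have "inverse (v ^ k) * (inverse v)\<^sup>2 = inverse (v ^ (k + 2))"
      by (simp add: power_add power_inverse power2_eq_square)
    ultimately show ?thesis by (simp only: divide_inverse)
  qed
  finally have g: "(g has_real_derivative bump (k + 2) (bump_step k q) s) (at s)" .
  show ?thesis
  proof (rule DERIV_cong_ev[THEN iffD1, OF refl _ refl g])
    have "eventually (\<lambda>x. x \<in> {-1<..<1}) (nhds s)"
      using s by (intro eventually_nhds_in_open) auto
    then show "\<forall>\<^sub>F x in nhds s. g x = bump k q x"
      by eventually_elim (auto simp: g_def i_def bump_def field_simps)
  qed
qed

text \<open>Near a point outside the open unit interval \<open>bump\<close> is quadratically small.\<close>

lemma bump_has_derivative_exterior:
  assumes s: "1 \<le> \<bar>s\<bar>"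
  shows "(bump k q has_real_derivative 0) (at s)"
proof -
  obtain M where M: "0 \<le> M" "\<And>s. \<bar>bump k q s\<bar> \<le> (if \<bar>s\<bar> < 1 then M * (1 - s\<^sup>2)\<^sup>2 else 0)"
    using bump_bound[of k q] by blast
  have bound: "\<bar>bump k q t\<bar> \<le> 4 * M * \<bar>t - s\<bar> * \<bar>t - s\<bar>" for t
  proof (cases "\<bar>t\<bar> < 1")
    case True
    \<comment> \<open>Since \<open>s\<close> lies outside the open interval, the first factor is at
      most the distance from \<open>t\<close> to \<open>s\<close>; the second is at most 2.\<close>
    have "1 - t\<^sup>2 = (1 - \<bar>t\<bar>) * (1 + \<bar>t\<bar>)" by (simp add: algebra_simps power2_eq_square)
    also have "\<dots> \<le> \<bar>t - s\<bar> * 2"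
      using True s by (intro mult_mono) auto
    finally have "(1 - t\<^sup>2)\<^sup>2 \<le> (\<bar>t - s\<bar> * 2)\<^sup>2"
      using one_minus_square_pos[OF True] by (intro power_mono) auto
    then have "M * (1 - t\<^sup>2)\<^sup>2 \<le> M * (\<bar>t - s\<bar> * 2)\<^sup>2"
      using M(1) by (rule mult_left_mono)
    moreover have "M * (d * 2)\<^sup>2 = 4 * M * d * d" for d :: real
      by (simp add: power2_eq_square)
    ultimately show ?thesis
      using M(2)[of t] True by fastforce
  qed (use M in \<open>auto simp: bump_def\<close>)
  have "((\<lambda>t. 4 * M * \<bar>t - s\<bar>) \<longlongrightarrow> 4 * M * \<bar>s - s\<bar>) (at s)"
    by (intro tendsto_intros)
  then have "((\<lambda>t. 4 * M * \<bar>t - s\<bar>) \<longlongrightarrow> 0) (at s)" by simp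
  moreover have "\<forall>\<^sub>F t in at s. norm ((bump k q t - bump k q s) / (t - s)) \<le> 4 * M * \<bar>t - s\<bar>"
    unfolding eventually_at_filter
  proof (intro always_eventually allI impI)
    fix t assume "t \<noteq> s"
    moreover have "bump k q s = 0" using s by (simp add: bump_def)
    ultimately show "norm ((bump k q t - bump k q s) / (t - s)) \<le> 4 * M * \<bar>t - s\<bar>"
      using bound[of t] by (simp add: pos_divide_le_eq)
  qed
  ultimately have "((\<lambda>t. (bump k q t - bump k q s) / (t - s)) \<longlongrightarrow> 0) (at s)"
    by (rule Lim_null_comparison[rotated])
  then show ?thesis
    by (simp add: has_field_derivative_iff)
qed

lemma bump_has_derivative:
  "(bump k q has_real_derivative bump (k + 2) (bump_step k q) s) (at s)"
proof (cases "\<bar>s\<bar> < 1")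
  case False
  then show ?thesis
    using bump_has_derivative_exterior[of s k q] by (simp add: bump_def)
qed (rule bump_has_derivative_interior)

lemma bump_smult: "bump k (smult c q) s = c * bump k q s"
  by (simp add: bump_def)

lemma bump_scaled_has_derivative:
  "((\<lambda>t. bump k q (t / \<tau>)) has_real_derivative bump (k + 2) (bump_step k q) (t / \<tau>) / \<tau>) (at t)"
proof -
  have "((\<lambda>t. t / \<tau>) has_real_derivative 1 / \<tau>) (at t)"
    using DERIV_cdivide[OF DERIV_ident] .
  from DERIV_chain2[OF bump_has_derivative this] show ?thesis by simp
qed

lemma smooth_bump_scaled: "smooth (\<lambda>t. bump k q (t / \<tau>))"
proof (rule smooth_if_in_class)
  define S where "S = range (\<lambda>(k, q) t. bump k q (t / \<tau>))"
  show "(\<lambda>t. bump k q (t / \<tau>)) \<in> S"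
    unfolding S_def by (rule range_eqI[of _ _ "(k, q)"]) simp
  fix g assume "g \<in> S"
  then obtain j r where g: "g = (\<lambda>t. bump j r (t / \<tau>))" by (auto simp: S_def)
  have D: "(g has_derivative (*) (bump (j + 2) (bump_step j r) (t / \<tau>) / \<tau>)) (at t)" for t
    using bump_scaled_has_derivative[of j r \<tau> t] unfolding g has_field_derivative_def .
  show "g differentiable (at x)" for x using D differentiableI by blast
  fix b :: real assume "b \<in> Basis"
  \<comment> \<open>The chain rule factor 1/\<tau> is moved into the polynomial, so the derivative
    stays in \<open>S\<close>.\<close>
  then have "partial_deriv b g = (\<lambda>t. bump (j + 2) (smult (1 / \<tau>) (bump_step j r)) (t / \<tau>))"
    by (intro ext) (simp add: partial_deriv_eq[OF D] bump_smult)
  then show "partial_deriv b g \<in> S"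
    unfolding S_def by (intro range_eqI[of _ _ "(j + 2, smult (1 / \<tau>) (bump_step j r))"]) simp
qed

text \<open>Both sides share the same exponential, so only the rational factors are compared. Order
  4 covers the first two derivatives of \<open>bump 0 1\<close>, whose pole orders are 2 and
  4.\<close>

lemma bump_le_weight:
  assumes "k \<le> 4"
  obtains M where "0 \<le> M"
    "\<And>s. \<bar>bump k q s\<bar> \<le> (if \<bar>s\<bar> < 1 then M / (1 - s\<^sup>2) ^ 4 else 0) * bump 0 1 s"
proof -
  obtain M where M: "0 \<le> M" "\<And>s. \<bar>s\<bar> < 1 \<Longrightarrow> \<bar>poly q s\<bar> \<le> M"
    using poly_bounded_unit_interval[of q] by blast
  have "\<bar>bump k q s\<bar> \<le> M / (1 - s\<^sup>2) ^ 4 * bump 0 1 s" if s: "\<bar>s\<bar> < 1" for s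
  proof -
    have v: "0 < 1 - s\<^sup>2" using one_minus_square_pos[OF s] .
    have "(1 - s\<^sup>2) ^ 4 \<le> (1 - s\<^sup>2) ^ k"
      using v assms by (intro power_decreasing) auto
    then have "\<bar>poly q s\<bar> / (1 - s\<^sup>2) ^ k \<le> M / (1 - s\<^sup>2) ^ 4"
      using M s v by (intro frac_le) auto
    from mult_right_mono[OF this, of "exp (- 1 / (1 - s\<^sup>2))"] show ?thesis
      using s v by (simp add: bump_def abs_mult)
  qed
  then show thesis using M(1) by (intro that[of M]) (auto simp: bump_def)
qed

text \<open>The constant \<open>M\<close> is fixed before \<tau>, since the lifespan argument varies
  \<tau>. The weight \<open>w\<close> compares the derivatives of \<eta> with \<eta> itself; it
  blows up at the end of the support, but \<eta> decays exponentially in 1/(1 - s^2) and absorbs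
  every power of it. The factor 2 leaves room for both time derivatives in the adjoint
  operator.\<close>

lemma time_cutoff:
  fixes r :: real
  assumes r: "0 < r"
  obtains M where "0 < M" "\<And>\<tau>. 1 \<le> \<tau> \<Longrightarrow> \<exists>\<eta> w. smooth \<eta> \<and> (\<forall>t\<ge>\<tau>. \<eta> t = 0) \<and> \<eta> 0 = exp (- 1) \<and> deriv \<eta> 0 = 0 \<and>
    (\<forall>t. 0 \<le> \<eta> t \<and> 0 \<le> w t \<and> \<bar>deriv \<eta> t\<bar> \<le> w t / \<tau> * \<eta> t \<and> \<bar>deriv (deriv \<eta>) t\<bar> \<le> w t / \<tau> * \<eta> t \<and>
      \<eta> t * (1 + 2 * w t) powr r \<le> M)"
proof -
  define q1 where "q1 = bump_step 0 1"
  define q2 where "q2 = bump_step 2 q1"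
  obtain M1 where M1: "0 \<le> M1"
    "\<And>s. \<bar>bump 2 q1 s\<bar> \<le> (if \<bar>s\<bar> < 1 then M1 / (1 - s\<^sup>2) ^ 4 else 0) * bump 0 1 s"
    using bump_le_weight[of 2 q1] by auto
  obtain M2 where M2: "0 \<le> M2"
    "\<And>s. \<bar>bump 4 q2 s\<bar> \<le> (if \<bar>s\<bar> < 1 then M2 / (1 - s\<^sup>2) ^ 4 else 0) * bump 0 1 s"
    using bump_le_weight[of 4 q2] by auto
  define K where "K = max M1 M2"
  define W where "W s = (if \<bar>s\<bar> < 1 then K / (1 - s\<^sup>2) ^ 4 else 0)" for s :: real
  have K: "0 \<le> K" using M1 by (simp add: K_def)
  have b0: "0 \<le> bump 0 1 s" for s by (simp add: bump_def)
  have W0: "0 \<le> W s" for s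
    using K one_minus_square_pos by (simp add: W_def)
  have B1: "\<bar>bump 2 q1 s\<bar> \<le> W s * bump 0 1 s" for s
    by (rule order_trans[OF M1(2)], intro mult_right_mono b0)
      (use one_minus_square_pos[of s] in \<open>auto simp: W_def K_def divide_right_mono\<close>)
  have B2: "\<bar>bump 4 q2 s\<bar> \<le> W s * bump 0 1 s" for s
    by (rule order_trans[OF M2(2)], intro mult_right_mono b0)
      (use one_minus_square_pos[of s] in \<open>auto simp: W_def K_def divide_right_mono\<close>)
  \<comment> \<open>With v = 1 - s^2, the weight \<open>1 + 2 * W s\<close> is at most (1 + 2K)/v^4,
    and \<open>powr_mult_exp_minus_le\<close> is applied to 1/v with exponent 4r.\<close>
  define M where "M = (1 + 2 * K) powr r * (4 * r) powr (4 * r)"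
  have BM: "bump 0 1 s * (1 + 2 * W s) powr r \<le> M" for s
  proof (cases "\<bar>s\<bar> < 1")
    case True
    define v where "v = 1 - s\<^sup>2"
    have v: "0 < v" "v \<le> 1" using one_minus_square_pos[OF True] by (auto simp: v_def)
    have "1 + 2 * W s \<le> (1 + 2 * K) * (1 / v) ^ 4"
    proof -
      have "1 \<le> (1 / v) ^ 4" using v by (intro one_le_power) simp
      then show ?thesis
        using True by (simp add: W_def v_def[symmetric] power_one_over add_divide_distrib)
    qed
    then have "(1 + 2 * W s) powr r \<le> ((1 + 2 * K) * (1 / v) ^ 4) powr r"
      using W0[of s] r by (intro powr_mono2) auto
    also have "\<dots> = (1 + 2 * K) powr r * (1 / v) powr (4 * r)"
    proof -
      have "((1 / v) ^ 4) powr r = (1 / v) powr (4 * r)"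
        using v powr_realpow[of "1 / v" 4] powr_powr[of "1 / v" 4 r] by simp
      then show ?thesis using K v by (simp add: powr_mult)
    qed
    finally have "bump 0 1 s * (1 + 2 * W s) powr r
        \<le> exp (- (1 / v)) * ((1 + 2 * K) powr r * (1 / v) powr (4 * r))"
      using True by (simp add: bump_def v_def)
    also have "\<dots> = (1 + 2 * K) powr r * ((1 / v) powr (4 * r) * exp (- (1 / v)))" by simp
    also have "\<dots> \<le> M"
      unfolding M_def using r v by (intro mult_left_mono powr_mult_exp_minus_le) auto
    finally show ?thesis .
  next
    case False
    then show ?thesis by (simp add: bump_def M_def)
  qed
  have d1: "deriv (\<lambda>t. bump 0 1 (t / \<tau>)) = (\<lambda>t. bump 2 q1 (t / \<tau>) / \<tau>)" for \<tau>
    using DERIV_imp_deriv[OF bump_scaled_has_derivative[of 0 1 \<tau>]] by (auto simp: q1_def numeral_2_eq_2)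
  have d2: "deriv (\<lambda>t. bump 2 q1 (t / \<tau>) / \<tau>) = (\<lambda>t. bump 4 q2 (t / \<tau>) / \<tau> / \<tau>)" for \<tau>
    using DERIV_imp_deriv[OF DERIV_cdivide[OF bump_scaled_has_derivative[of 2 q1 \<tau>]]]
    by (auto simp: q2_def)
  have "\<exists>\<eta> w. smooth \<eta> \<and> (\<forall>t\<ge>\<tau>. \<eta> t = 0) \<and> \<eta> 0 = exp (- 1) \<and> deriv \<eta> 0 = 0 \<and>
    (\<forall>t. 0 \<le> \<eta> t \<and> 0 \<le> w t \<and> \<bar>deriv \<eta> t\<bar> \<le> w t / \<tau> * \<eta> t \<and> \<bar>deriv (deriv \<eta>) t\<bar> \<le> w t / \<tau> * \<eta> t \<and>
      \<eta> t * (1 + 2 * w t) powr r \<le> M)" if \<tau>: "1 \<le> \<tau>" for \<tau> :: real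
  proof (intro exI conjI allI impI)
    let ?\<eta> = "\<lambda>t. bump 0 1 (t / \<tau>)" and ?w = "\<lambda>t. W (t / \<tau>)"
    show "smooth ?\<eta>" by (rule smooth_bump_scaled)
    show "\<tau> \<le> t \<Longrightarrow> ?\<eta> t = 0" for t using \<tau> by (simp add: bump_def)
    show "?\<eta> 0 = exp (- 1)" by (simp add: bump_def)
    show "deriv ?\<eta> 0 = 0" unfolding d1 by (simp add: bump_def q1_def bump_step_def)
    fix t
    show "0 \<le> ?\<eta> t" by (rule b0)
    show "0 \<le> ?w t" by (rule W0)
    show "\<bar>deriv ?\<eta> t\<bar> \<le> ?w t / \<tau> * ?\<eta> t"
      unfolding d1 using B1[of "t / \<tau>"] \<tau> by (simp add: divide_right_mono)
    \<comment> \<open>The second derivative carries two factors 1/\<tau>. One of them is given away,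
      using \<tau> \<ge> 1, so that both derivatives have the same scale.\<close>
    have "\<bar>bump 4 q2 (t / \<tau>)\<bar> / \<tau> \<le> W (t / \<tau>) * bump 0 1 (t / \<tau>) / 1"
      using B2[of "t / \<tau>"] \<tau> W0[of "t / \<tau>"] b0[of "t / \<tau>"] by (intro frac_le) auto
    then show "\<bar>deriv (deriv ?\<eta>) t\<bar> \<le> ?w t / \<tau> * ?\<eta> t"
      unfolding d1 d2 using divide_right_mono[of _ _ \<tau>] \<tau> by fastforce
    show "?\<eta> t * (1 + 2 * ?w t) powr r \<le> M" by (rule BM)
  qed
  moreover have "0 < M" unfolding M_def using r K by (intro mult_pos_pos) auto
  ultimately show thesis by (rule that[rotated])
qed

subsection \<open>Gaussian cutoffs in space\<close>

lemma power2_norm_eq_sum_Basis: "(norm x)\<^sup>2 = (\<Sum>b\<in>Basis. (x \<bullet> b)\<^sup>2)" for x :: "'a::euclidean_space"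
  by (subst power2_norm_eq_inner, subst euclidean_inner) (simp add: power2_eq_square)

lemma real_polynomial_function_has_derivative:
  fixes q :: "'a::euclidean_space \<Rightarrow> real"
  assumes "real_polynomial_function q"
  obtains q' where "\<And>x. (q has_derivative q' x) (at x)" "\<And>b. real_polynomial_function (\<lambda>x. q' x b)"
  using assms
proof (induction q arbitrary: thesis rule: real_polynomial_function.induct)
  case (linear f)
  show ?case
    by (rule linear(2)[of "\<lambda>_. f"])
      (use linear(1) in \<open>auto intro: bounded_linear_imp_has_derivative\<close>)
next
  case (const c)
  show ?case by (rule const[of "\<lambda>_ _. 0"]) auto
next
  case (add f g)
  obtain f' where f': "\<And>x. (f has_derivative f' x) (at x)" "\<And>b. real_polynomial_function (\<lambda>x. f' x b)"
    using add.IH(1) by blast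
  obtain g' where g': "\<And>x. (g has_derivative g' x) (at x)" "\<And>b. real_polynomial_function (\<lambda>x. g' x b)"
    using add.IH(2) by blast
  show ?case
    by (rule add.prems[of "\<lambda>x b. f' x b + g' x b"]) (auto intro!: f' g' has_derivative_add)
next
  case (mult f g)
  obtain f' where f': "\<And>x. (f has_derivative f' x) (at x)" "\<And>b. real_polynomial_function (\<lambda>x. f' x b)"
    using mult.IH(1) by blast
  obtain g' where g': "\<And>x. (g has_derivative g' x) (at x)" "\<And>b. real_polynomial_function (\<lambda>x. g' x b)"
    using mult.IH(2) by blast
  show ?case
    by (rule mult.prems[of "\<lambda>x b. f x * g' x b + f' x b * g x"])
      (use mult.hyps in \<open>auto intro!: f' g' has_derivative_mult\<close>)
qed

text \<open>The induction keeps \<delta> arbitrary, because for a product each factor is estimated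
  with \<delta>/2.\<close>

lemma real_polynomial_function_le_exp:
  fixes q :: "'a::euclidean_space \<Rightarrow> real" and \<delta> :: real
  assumes "real_polynomial_function q" "0 < \<delta>"
  obtains C where "0 \<le> C" "\<And>x. \<bar>q x\<bar> \<le> C * exp (\<delta> * (norm x)\<^sup>2)"
  using assms
proof (induction q arbitrary: \<delta> thesis rule: real_polynomial_function.induct)
  case (linear f)
  obtain K where K: "0 \<le> K" "\<And>x. \<bar>f x\<bar> \<le> norm x * K"
    using bounded_linear.nonneg_bounded[OF linear(1)] by auto
  have "norm x \<le> (1 + 1 / \<delta>) * exp (\<delta> * (norm x)\<^sup>2)" for x :: 'a
  proof -
    have "norm x \<le> 1 + (norm x)\<^sup>2"
    proof -
      have "2 * norm x \<le> (norm x)\<^sup>2 + 1" using sum_squares_bound[of "norm x" 1] by simp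
      then show ?thesis using norm_ge_zero[of x] by linarith
    qed
    also have "\<dots> \<le> (1 + 1 / \<delta>) * (1 + \<delta> * (norm x)\<^sup>2)"
    proof -
      have "(1 + 1 / \<delta>) * (1 + \<delta> * (norm x)\<^sup>2) = 1 + (norm x)\<^sup>2 + (1 / \<delta> + \<delta> * (norm x)\<^sup>2)"
        using linear(3) by (simp add: field_simps)
      then show ?thesis using linear(3) by simp
    qed
    also have "\<dots> \<le> (1 + 1 / \<delta>) * exp (\<delta> * (norm x)\<^sup>2)"
      using linear(3) by (intro mult_left_mono exp_ge_add_one_self) auto
    finally show ?thesis .
  qed
  then have "\<bar>f x\<bar> \<le> K * (1 + 1 / \<delta>) * exp (\<delta> * (norm x)\<^sup>2)" for x
    using K(2)[of x] K(1) mult_left_mono[of "norm x" _ K] by (fastforce simp: mult_ac)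
  then show ?case
    using K(1) linear(3) by (intro linear(2)[of "K * (1 + 1 / \<delta>)"]) auto
next
  case (const c)
  have "\<bar>c\<bar> * 1 \<le> \<bar>c\<bar> * exp (\<delta> * (norm x)\<^sup>2)" for x :: 'a
    using const(2) by (intro mult_left_mono) auto
  then show ?case by (intro const(1)[of "\<bar>c\<bar>"]) auto
next
  case (add f g)
  obtain C where C: "0 \<le> C" "\<And>x. \<bar>f x\<bar> \<le> C * exp (\<delta> * (norm x)\<^sup>2)"
    using add.IH(1) add.prems(2) by blast
  obtain D where D: "0 \<le> D" "\<And>x. \<bar>g x\<bar> \<le> D * exp (\<delta> * (norm x)\<^sup>2)"
    using add.IH(2) add.prems(2) by blast
  have "\<bar>f x + g x\<bar> \<le> (C + D) * exp (\<delta> * (norm x)\<^sup>2)" for x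
    using C(2)[of x] D(2)[of x] by (simp add: algebra_simps)
  then show ?case using C D by (intro add.prems(1)[of "C + D"]) auto
next
  case (mult f g)
  have \<delta>: "0 < \<delta> / 2" using mult.prems(2) by simp
  obtain C where C: "0 \<le> C" "\<And>x. \<bar>f x\<bar> \<le> C * exp (\<delta> / 2 * (norm x)\<^sup>2)"
    using mult.IH(1) \<delta> by blast
  obtain D where D: "0 \<le> D" "\<And>x. \<bar>g x\<bar> \<le> D * exp (\<delta> / 2 * (norm x)\<^sup>2)"
    using mult.IH(2) \<delta> by blast
  have "\<bar>f x * g x\<bar> \<le> C * D * exp (\<delta> * (norm x)\<^sup>2)" for x
  proof -
    have "\<bar>f x * g x\<bar> \<le> (C * exp (\<delta> / 2 * (norm x)\<^sup>2)) * (D * exp (\<delta> / 2 * (norm x)\<^sup>2))"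
      unfolding abs_mult using C D by (intro mult_mono) auto
    also have "\<dots> = C * D * exp (\<delta> / 2 * (norm x)\<^sup>2 + \<delta> / 2 * (norm x)\<^sup>2)"
      by (simp only: exp_add mult_ac)
    finally show ?thesis by (simp add: field_simps)
  qed
  then show ?case using C D by (intro mult.prems(1)[of "C * D"]) auto
qed

text \<open>The integrand factors over the coordinates, and each factor is a multiple of the normal
  density with standard deviation \<open>R\<close>.\<close>

lemma gaussian_integral:
  fixes R :: real
  assumes "0 < R"
  shows "has_bochner_integral lborel (\<lambda>x::'a::euclidean_space. exp (- (norm x)\<^sup>2 / (2 * R\<^sup>2)))
    ((sqrt (2 * pi) * R) ^ DIM('a))"
proof (rule has_bochner_integral_nn_integral)
  have 1: "(\<integral>\<^sup>+t. ennreal (exp (- t\<^sup>2 / (2 * R\<^sup>2))) \<partial>lborel) = ennreal (sqrt (2 * pi) * R)"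
  proof -
    have eq: "exp (- t\<^sup>2 / (2 * R\<^sup>2)) = (sqrt (2 * pi) * R) * normal_density 0 R t" for t
      using assms by (simp add: normal_density_def real_sqrt_mult)
    have "(\<integral>\<^sup>+t. ennreal (normal_density 0 R t) \<partial>lborel) = ennreal 1"
      using assms by (subst nn_integral_eq_integral) auto
    then show ?thesis
      using assms unfolding eq by (simp add: ennreal_mult nn_integral_cmult)
  qed
  have eq: "ennreal (exp (- (norm x)\<^sup>2 / (2 * R\<^sup>2))) = (\<Prod>b\<in>Basis. ennreal (exp (- (x \<bullet> b)\<^sup>2 / (2 * R\<^sup>2))))"
    for x :: 'a
    by (simp add: prod_ennreal exp_sum[symmetric] power2_norm_eq_sum_Basis sum_negf sum_divide_distrib)
  show "(\<integral>\<^sup>+x. ennreal (exp (- (norm x)\<^sup>2 / (2 * R\<^sup>2))) \<partial>(lborel :: 'a measure))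
      = ennreal ((sqrt (2 * pi) * R) ^ DIM('a))"
    unfolding eq
    using assms 1 by (subst nn_integral_lborel_prod) (auto simp: ennreal_power)
qed (use assms in auto)

section \<open>Derivatives of polynomials times Gaussians\<close>

lemma polynomial_times_gaussian_has_derivative:
  assumes "(q has_derivative q') (at x)"
  shows "((\<lambda>x. q x * exp (- c * (norm x)\<^sup>2)) has_derivative
    (\<lambda>h. (q' h - 2 * c * (x \<bullet> h) * q x) * exp (- c * (norm x)\<^sup>2))) (at (x::'a::euclidean_space))"
  unfolding power2_norm_eq_inner
  by (rule derivative_eq_intros assms refl)+ (auto simp: algebra_simps inner_commute)

lemma gaussian_derivative_class:
  fixes c :: real
  defines "S \<equiv> {(\<lambda>x::'a::euclidean_space. q x * exp (- c * (norm x)\<^sup>2)) |q. real_polynomial_function q}"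
  assumes g: "g \<in> S"
  shows "g differentiable (at x)" "partial_deriv b g \<in> S"
proof -
  obtain q where q: "real_polynomial_function q" "g = (\<lambda>x. q x * exp (- c * (norm x)\<^sup>2))"
    using g by (auto simp: S_def)
  obtain q' where q': "\<And>x. (q has_derivative q' x) (at x)" "\<And>b. real_polynomial_function (\<lambda>x. q' x b)"
    using real_polynomial_function_has_derivative[OF q(1)] by blast
  note D = polynomial_times_gaussian_has_derivative[OF q'(1), where c=c, folded q(2)]
  show "g differentiable (at x)" using D differentiableI by blast
  have "real_polynomial_function (\<lambda>x. q' x b - 2 * c * (x \<bullet> b) * q x)"
    by (intro real_polynomial_function_diff real_polynomial_function.intros q q' bounded_linear_inner_left)
  moreover have "partial_deriv b g = (\<lambda>x. (q' x b - 2 * c * (x \<bullet> b) * q x) * exp (- c * (norm x)\<^sup>2))"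
    by (intro ext partial_deriv_eq[OF D])
  ultimately show "partial_deriv b g \<in> S"
    unfolding S_def by (intro CollectI exI[of _ "\<lambda>x. q' x b - 2 * c * (x \<bullet> b) * q x"] conjI)
qed

lemma continuous_real_polynomial_function:
  fixes q :: "'a::euclidean_space \<Rightarrow> real"
  assumes "real_polynomial_function q"
  shows "continuous_on UNIV q"
  using real_polynomial_function_has_derivative[OF assms]
  by (metis has_derivative_at_withinI has_derivative_continuous_on)

lemma space_test_function_gaussian:
  fixes R :: real
  assumes R: "0 < R"
  shows "space_test_function (\<lambda>x::'a::euclidean_space. exp (- (1 / R\<^sup>2) * (norm x)\<^sup>2))"
  (is "space_test_function ?\<phi>")
proof -
  define c where "c = 1 / R\<^sup>2"
  have c: "0 < c" using R by (simp add: c_def)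
  define S where "S = {(\<lambda>x::'a. q x * exp (- c * (norm x)\<^sup>2)) |q. real_polynomial_function q}"
  have mem: "?\<phi> \<in> S"
    unfolding S_def c_def[symmetric] by (auto intro!: exI[of _ "\<lambda>_. 1"])
  have diff: "\<And>g x. g \<in> S \<Longrightarrow> g differentiable (at x)"
    and pd: "\<And>g b. g \<in> S \<Longrightarrow> partial_deriv b g \<in> S"
    unfolding S_def using gaussian_derivative_class by blast+
  have "smooth ?\<phi>" by (rule smooth_if_in_class[OF mem diff pd])
  moreover have "integrable lborel g \<and> bounded (range g)" if "g \<in> S" for g
  proof -
    obtain q where q: "real_polynomial_function q" "g = (\<lambda>x. q x * exp (- c * (norm x)\<^sup>2))"
      using \<open>g \<in> S\<close> by (auto simp: S_def)
    \<comment> \<open>Half of the Gaussian decay pays for the polynomial; the other half gives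
      integrability and boundedness.\<close>
    obtain C where C: "0 \<le> C" "\<And>x. \<bar>q x\<bar> \<le> C * exp (c / 2 * (norm x)\<^sup>2)"
      using real_polynomial_function_le_exp[OF q(1), of "c / 2"] c by auto
    have bound: "\<bar>g x\<bar> \<le> C * exp (- (norm x)\<^sup>2 / (2 * R\<^sup>2))" for x
    proof -
      have "\<bar>g x\<bar> \<le> C * exp (c / 2 * (norm x)\<^sup>2) * exp (- c * (norm x)\<^sup>2)"
        unfolding q(2) abs_mult using C by (intro mult_mono) auto
      also have "\<dots> = C * exp (c / 2 * (norm x)\<^sup>2 + - c * (norm x)\<^sup>2)"
        by (simp only: exp_add mult.assoc)
      also have "c / 2 * (norm x)\<^sup>2 + - c * (norm x)\<^sup>2 = - (norm x)\<^sup>2 / (2 * R\<^sup>2)"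
        by (simp add: c_def field_simps)
      finally show ?thesis .
    qed
    have meas: "g \<in> borel_measurable lborel"
      unfolding q(2) by (auto intro!: borel_measurable_continuous_onI continuous_intros
          continuous_real_polynomial_function[OF q(1)])
    have "integrable lborel (\<lambda>x::'a. C * exp (- (norm x)\<^sup>2 / (2 * R\<^sup>2)))"
      using gaussian_integral[OF R] by (intro integrable_mult_right) (auto simp: has_bochner_integral_iff)
    then have "integrable lborel g"
      by (rule Bochner_Integration.integrable_bound) (use meas bound C(1) in \<open>auto simp: abs_mult\<close>)
    moreover have "\<bar>g x\<bar> \<le> C" for x
    proof -
      have "C * exp (- (norm x)\<^sup>2 / (2 * R\<^sup>2)) \<le> C * 1"
        using C(1) R by (intro mult_left_mono) auto
      with bound[of x] show ?thesis by simp
    qed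
    then have "bounded (range g)" by (auto simp: bounded_iff)
    ultimately show ?thesis by simp
  qed
  ultimately show ?thesis
    unfolding space_test_function_def using partial_derivs_in_class[OF mem pd] by blast
qed

lemma laplacian_gaussian:
  "laplacian (\<lambda>x::'a::euclidean_space. exp (- c * (norm x)\<^sup>2)) x
    = (4 * c\<^sup>2 * (norm x)\<^sup>2 - 2 * c * DIM('a)) * exp (- c * (norm x)\<^sup>2)"
proof -
  have 1: "partial_deriv b (\<lambda>x::'a. exp (- c * (norm x)\<^sup>2)) = (\<lambda>x. (- 2 * c * (x \<bullet> b)) * exp (- c * (norm x)\<^sup>2))" for b
    using partial_deriv_eq[OF polynomial_times_gaussian_has_derivative[of "\<lambda>_. 1" "\<lambda>_. 0" _ c]]
    by fastforce
  have 2: "partial_deriv b (\<lambda>x::'a. (- 2 * c * (x \<bullet> b)) * exp (- c * (norm x)\<^sup>2)) x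
      = (4 * c\<^sup>2 * (x \<bullet> b)\<^sup>2 - 2 * c) * exp (- c * (norm x)\<^sup>2)" if "b \<in> Basis" for b
  proof -
    have "((\<lambda>x. - 2 * c * (x \<bullet> b)) has_derivative (\<lambda>h. - 2 * c * (h \<bullet> b))) (at x)"
      by (auto intro!: derivative_eq_intros)
    from partial_deriv_eq[OF polynomial_times_gaussian_has_derivative[OF this, of c], of b]
    show ?thesis using that by (simp add: power2_eq_square algebra_simps)
  qed
  have "laplacian (\<lambda>x::'a. exp (- c * (norm x)\<^sup>2)) x
      = (\<Sum>b\<in>Basis. (4 * c\<^sup>2 * (x \<bullet> b)\<^sup>2 - 2 * c) * exp (- c * (norm x)\<^sup>2))"
    unfolding laplacian_def partial_derivs.simps 1 by (intro sum.cong refl 2)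
  also have "\<dots> = (4 * c\<^sup>2 * (\<Sum>b\<in>Basis. (x \<bullet> b)\<^sup>2) - 2 * c * DIM('a)) * exp (- c * (norm x)\<^sup>2)"
    by (simp add: sum_distrib_right[symmetric] sum_subtractf sum_distrib_left)
  also have "(\<Sum>b\<in>Basis. (x \<bullet> b)\<^sup>2) = (norm x)\<^sup>2"
    by (simp add: power2_norm_eq_sum_Basis)
  finally show ?thesis .
qed

text \<open>In the variable |x|/R the estimate is scale free apart from the factor
  \<open>R powr a\<close>, hence \<open>M\<close> does not depend on \<open>R\<close>. The power of
  |x| is the one that Young's inequality produces from the singular weight of the nonlinearity. Half
  of the Gaussian absorbs all powers, and the other half stays integrable.\<close>

lemma space_cutoff:
  fixes r a :: real
  assumes r: "0 < r" and a: "0 \<le> a"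
  obtains M where "0 < M" "\<And>R. 0 < R \<Longrightarrow> \<exists>B. \<forall>x::'a::euclidean_space. 0 \<le> B x \<and>
    \<bar>laplacian (\<lambda>x. exp (- (1 / R\<^sup>2) * (norm x)\<^sup>2)) x\<bar> \<le> B x / R\<^sup>2 * exp (- (1 / R\<^sup>2) * (norm x)\<^sup>2) \<and>
    exp (- (1 / R\<^sup>2) * (norm x)\<^sup>2) * norm x powr a * (1 + B x) powr r
      \<le> M * R powr a * exp (- (norm x)\<^sup>2 / (2 * R\<^sup>2))"
proof -
  \<comment> \<open>With y = |x|/R, the Laplacian contributes the factor 4y^2 - 2 DIM, up to 1/R^2.
    Its absolute value is at most \<open>N - 1 + 4 * y^2\<close>, which is the \<open>B\<close>
    chosen below.\<close>
  define N where "N = 1 + 2 * real DIM('a)"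
  define m where "m = a + r"
  define M where "M = 8 powr m * m powr m * exp (N / 8)"
  have m: "0 < m" using r a by (simp add: m_def)
  have N: "1 \<le> N" by (simp add: N_def)
  have key: "exp (- y\<^sup>2) * y powr a * (N + 4 * y\<^sup>2) powr r \<le> M * exp (- y\<^sup>2 / 2)" if y: "0 \<le> y" for y
  proof -
    \<comment> \<open>\<open>Z\<close> dominates both \<open>y\<close> and the weight, so a single
      power Z^(a + r) remains. It is absorbed at scale 1/8 because exp (Z/8) is exp (y^2/2) up to a
      constant.\<close>
    define Z where "Z = N + 4 * y\<^sup>2"
    have "y \<le> 1 + y\<^sup>2"
      using sum_squares_bound[of y 1] y by (simp add: power2_eq_square)
    then have yZ: "y \<le> Z" and Z0: "0 < Z"
      using N zero_le_power2[of y] unfolding Z_def by linarith+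
    have "y powr a * Z powr r \<le> Z powr a * Z powr r"
      using yZ y a by (intro mult_right_mono powr_mono2) auto
    also have "\<dots> = Z powr m" by (simp add: m_def powr_add)
    also have "\<dots> = 8 powr m * (Z / 8) powr m"
      using Z0 by (simp add: powr_divide)
    also have "\<dots> \<le> 8 powr m * (m powr m * exp (Z / 8))"
    proof (intro mult_left_mono)
      show "(Z / 8) powr m \<le> m powr m * exp (Z / 8)"
        using powr_mult_exp_minus_le[of "Z / 8" m] Z0 m by (simp add: exp_minus field_simps)
    qed auto
    also have "exp (Z / 8) = exp (N / 8) * exp (y\<^sup>2 / 2)"
      unfolding Z_def exp_add[symmetric] by (simp add: add_divide_distrib)
    finally have "y powr a * Z powr r \<le> M * exp (y\<^sup>2 / 2)"
      by (simp add: M_def mult_ac)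
    then have "exp (- y\<^sup>2) * (y powr a * Z powr r) \<le> exp (- y\<^sup>2) * (M * exp (y\<^sup>2 / 2))"
      by (intro mult_left_mono) auto
    also have "\<dots> = M * exp (- y\<^sup>2 + y\<^sup>2 / 2)" unfolding exp_add by simp
    also have "- y\<^sup>2 + y\<^sup>2 / 2 = - y\<^sup>2 / 2" by simp
    finally show ?thesis by (simp add: Z_def mult.assoc)
  qed
  show thesis
  proof (rule that[of M])
    show "0 < M" using m by (simp add: M_def)
    fix R :: real assume R: "0 < R"
    define B where "B x = N - 1 + 4 * (norm x / R)\<^sup>2" for x :: 'a
    show "\<exists>B. \<forall>x::'a. 0 \<le> B x \<and>
      \<bar>laplacian (\<lambda>x. exp (- (1 / R\<^sup>2) * (norm x)\<^sup>2)) x\<bar> \<le> B x / R\<^sup>2 * exp (- (1 / R\<^sup>2) * (norm x)\<^sup>2) \<and>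
      exp (- (1 / R\<^sup>2) * (norm x)\<^sup>2) * norm x powr a * (1 + B x) powr r
        \<le> M * R powr a * exp (- (norm x)\<^sup>2 / (2 * R\<^sup>2))"
    proof (intro exI[of _ B] allI conjI)
      fix x :: 'a
      show "0 \<le> B x" using N by (simp add: B_def)
      have "\<bar>4 * (1 / R\<^sup>2)\<^sup>2 * (norm x)\<^sup>2 - 2 * (1 / R\<^sup>2) * DIM('a)\<bar>
          \<le> \<bar>4 * (1 / R\<^sup>2)\<^sup>2 * (norm x)\<^sup>2\<bar> + \<bar>2 * (1 / R\<^sup>2) * DIM('a)\<bar>"
        by (rule abs_triangle_ineq4)
      also have "\<dots> = B x / R\<^sup>2"
        using R by (simp add: B_def N_def power_divide power_one_over abs_mult field_simps)
      finally show "\<bar>laplacian (\<lambda>x. exp (- (1 / R\<^sup>2) * (norm x)\<^sup>2)) x\<bar>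
          \<le> B x / R\<^sup>2 * exp (- (1 / R\<^sup>2) * (norm x)\<^sup>2)"
        unfolding laplacian_gaussian abs_mult abs_exp_cancel by (rule mult_right_mono) simp
      have "norm x powr a = R powr a * (norm x / R) powr a"
        using R by (simp add: powr_divide)
      moreover have "1 + B x = N + 4 * (norm x / R)\<^sup>2" by (simp add: B_def)
      moreover have "- (1 / R\<^sup>2) * (norm x)\<^sup>2 = - (norm x / R)\<^sup>2"
        and "- (norm x)\<^sup>2 / (2 * R\<^sup>2) = - (norm x / R)\<^sup>2 / 2"
        by (auto simp: power_divide)
      moreover have "R powr a * (exp (- (norm x / R)\<^sup>2) * (norm x / R) powr a * (N + 4 * (norm x / R)\<^sup>2) powr r)
          \<le> R powr a * (M * exp (- (norm x / R)\<^sup>2 / 2))"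
        using R by (intro mult_left_mono key) auto
      ultimately show "exp (- (1 / R\<^sup>2) * (norm x)\<^sup>2) * norm x powr a * (1 + B x) powr r
          \<le> M * R powr a * exp (- (norm x)\<^sup>2 / (2 * R\<^sup>2))"
        by (simp only: mult_ac)
    qed
  qed
qed

subsection \<open>The test function estimate\<close>

lemma integral_product_lborel:
  fixes f :: "'a::euclidean_space \<Rightarrow> real" and g :: "'b::euclidean_space \<Rightarrow> real"
  assumes f: "integrable lborel f" and g: "integrable lborel g"
  shows "integrable lborel (\<lambda>(x, y). f x * g y)"
    and "(LINT (x, y)|lborel. f x * g y) = (LINT x|lborel. f x) * (LINT y|lborel. g y)"
proof -
  have [measurable]: "f \<in> borel_measurable lborel" "g \<in> borel_measurable lborel"
    using f g by auto
  have int: "integrable (lborel \<Otimes>\<^sub>M lborel) (\<lambda>z. f (fst z) * g (snd z))"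
  proof (rule lborel_pair.Fubini_integrable)
    show "integrable lborel (\<lambda>x. LINT y|lborel. norm (f (fst (x, y)) * g (snd (x, y))))"
      using f by (simp add: abs_mult)
  qed (use g in auto)
  from int show "integrable lborel (\<lambda>(x, y). f x * g y)"
    by (simp add: lborel_prod case_prod_beta')
  from lborel_pair.integral_fst'[OF int]
  show "(LINT (x, y)|lborel. f x * g y) = (LINT x|lborel. f x) * (LINT y|lborel. g y)"
    by (simp add: lborel_prod case_prod_beta')
qed

text \<open>Split U G as (X^(-a/p) U)(X^(a/p) G), apply Young's inequality with conjugate exponents,
  and estimate the factors 1/p and 1/p' by 1. Keeping \<open>W\<close> outside the powers makes the
  first term on the right the integrand of the nonlinear term.\<close>

lemma weighted_Young:
  fixes p p' a U X G W :: real
  assumes p: "1 < p" "p' = p / (p - 1)" and X: "0 < X" and nn: "0 \<le> U" "0 \<le> G" "0 \<le> W"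
  shows "U * (W * G) \<le> X powr (- a) * U powr p * W + W * X powr (a / (p - 1)) * G powr p'"
proof -
  have p': "1 < p'" "1 / p + 1 / p' = 1" unfolding p(2) using p(1) by (simp_all add: less_divide_eq add_divide_distrib[symmetric])
  have "(X powr (- a / p) * U) * (X powr (a / p) * G)
      \<le> (X powr (- a / p) * U) powr p / p + (X powr (a / p) * G) powr p' / p'"
    using p p' nn by (intro Youngs_inequality) auto
  also have "\<dots> \<le> (X powr (- a / p) * U) powr p + (X powr (a / p) * G) powr p'"
  proof -
    have "y / q \<le> y" if "0 \<le> y" "1 < q" for y q :: real
      using that by (simp add: divide_le_eq mult_le_cancel_left1)
    then show ?thesis using p(1) p'(1) by (intro add_mono) auto
  qed
  also have "(X powr (- a / p) * U) powr p = X powr (- a) * U powr p"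
    using p nn X by (simp add: powr_mult powr_powr)
  also have "(X powr (a / p) * G) powr p' = X powr (a / (p - 1)) * G powr p'"
    using p nn X by (simp add: powr_mult powr_powr)
  also have "(X powr (- a / p) * U) * (X powr (a / p) * G) = U * G"
    using X by (simp add: powr_add[symmetric])
  finally have "W * (U * G) \<le> W * (X powr (- a) * U powr p + X powr (a / (p - 1)) * G powr p')"
    using nn(3) by (rule mult_left_mono)
  then show ?thesis by (simp add: algebra_simps)
qed

text \<open>The argument has two rounds. Bounding the logarithm by a multiple of R^(d/2) gives the
  crude estimate R^(d/2) \<le> const/\<epsilon>, so ln R is at most a multiple of ln (1/\<epsilon>).
  Inserting this into the hypothesis yields the bound with the correct logarithm.\<close>

lemma lifespan_inequality_inversion:
  fixes C d :: real
  assumes C: "0 < C" and d: "0 < d"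
  obtains C' where "1 \<le> C'"
    "\<And>\<epsilon> R. 0 < \<epsilon> \<Longrightarrow> \<epsilon> \<le> exp (- 1) \<Longrightarrow> 1 \<le> R \<Longrightarrow> \<epsilon> * R powr d \<le> C * ln (exp 1 + R) \<Longrightarrow>
      R powr d \<le> C' * (ln (inverse \<epsilon>) / \<epsilon>)"
proof -
  define A where "A = 4 powr (d / 2) / (d / 2)"
  define D where "D = ln 4 + 2 / d * (\<bar>ln (C * A)\<bar> + 1)"
  have A: "0 < A" using d by (simp add: A_def)
  show thesis
  \<comment> \<open>\<open>A\<close> belongs to the crude estimate of the logarithm and
    \<open>D\<close> to ln (e + R) \<le> D ln (1/\<epsilon>). The maximum secures 1 \<le> C', from
    which the final proof gets \<open>1 \<le> Z\<close>.\<close>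
  proof (rule that[of "max 1 (C * D)"])
    fix \<epsilon> R :: real
    assume \<epsilon>: "0 < \<epsilon>" "\<epsilon> \<le> exp (- 1)" and R: "1 \<le> R" and le: "\<epsilon> * R powr d \<le> C * ln (exp 1 + R)"
    define L where "L = ln (inverse \<epsilon>)"
    have "ln \<epsilon> \<le> ln (exp (- 1))" using \<epsilon> by (subst ln_le_cancel_iff) auto
    \<comment> \<open>This lets additive constants be absorbed into multiples of
      \<open>L\<close>.\<close>
    then have L: "1 \<le> L" using \<epsilon> by (simp add: L_def ln_inverse)
    have "exp 1 + R \<le> 4 * R" using R exp_le by simp
    then have ln: "ln (exp 1 + R) \<le> ln (4 * R)"
      using R by (subst ln_le_cancel_iff) (auto intro: add_pos_pos)
    also have "\<dots> \<le> (4 * R) powr (d / 2) / (d / 2)"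
      using R d by (intro ln_powr_bound) auto
    also have "\<dots> = A * R powr (d / 2)"
      using R by (simp add: A_def powr_mult)
    finally have "C * ln (exp 1 + R) \<le> C * (A * R powr (d / 2))"
      using C by (intro mult_left_mono) auto
    with le have "\<epsilon> * R powr d \<le> C * A * R powr (d / 2)" by (simp add: mult.assoc)
    moreover have "R powr d = R powr (d / 2) * R powr (d / 2)"
      using powr_add[of R "d / 2" "d / 2"] by simp
    moreover have "0 < R powr (d / 2)" using R by simp
    ultimately have "\<epsilon> * R powr (d / 2) \<le> C * A" by simp
    then have "R powr (d / 2) \<le> C * A * inverse \<epsilon>"
      using \<epsilon> by (simp add: field_simps)
    then have "ln (R powr (d / 2)) \<le> ln (C * A * inverse \<epsilon>)"
      using R C A \<epsilon> by (subst ln_le_cancel_iff) auto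
    also have "\<dots> = ln (C * A) + L"
      using C A \<epsilon> by (simp add: L_def ln_mult)
    also have "\<dots> \<le> (\<bar>ln (C * A)\<bar> + 1) * L"
    proof -
      have "\<bar>ln (C * A)\<bar> * 1 \<le> \<bar>ln (C * A)\<bar> * L" using L by (intro mult_left_mono) auto
      then show ?thesis by (simp add: algebra_simps)
    qed
    finally have "d / 2 * ln R \<le> (\<bar>ln (C * A)\<bar> + 1) * L"
      using R by (simp add: ln_powr)
    then have "ln R \<le> 2 / d * (\<bar>ln (C * A)\<bar> + 1) * L"
      using d by (simp add: field_simps)
    moreover have "ln 4 * 1 \<le> ln 4 * L" using L by (intro mult_left_mono) auto
    moreover have "ln (4 * R) = ln 4 + ln R" using R by (simp add: ln_mult)
    moreover have "D * L = ln 4 * L + 2 / d * (\<bar>ln (C * A)\<bar> + 1) * L"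
      by (simp add: D_def distrib_right)
    ultimately have "ln (exp 1 + R) \<le> D * L"
      using ln by linarith
    then have "C * ln (exp 1 + R) \<le> C * (D * L)"
      using C by (intro mult_left_mono) auto
    with le have "R powr d * \<epsilon> \<le> C * D * L" by (simp add: mult_ac)
    then have "R powr d \<le> C * D * (L / \<epsilon>)"
      using \<epsilon> by (simp add: pos_le_divide_eq)
    also have "\<dots> \<le> max 1 (C * D) * (L / \<epsilon>)"
      using L \<epsilon> by (intro mult_right_mono) auto
    finally show "R powr d \<le> max 1 (C * D) * (ln (inverse \<epsilon>) / \<epsilon>)" by (simp add: L_def)
  qed auto
qed

text \<open>The constant is chosen before the data, \<epsilon>, \<open>T\<close> and
  \<open>R\<close>. The exponent counts the Young remainder: with \<tau> = R^2 and p' = p/(p - 1),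
  its size R^(\<alpha>/(p - 1)) \<tau>^(-p') is integrated over a region of volume comparable to
  \<tau> R^n.\<close>

lemma weak_solution_test_bound:
  fixes \<alpha> p :: real
  assumes \<alpha>: "0 \<le> \<alpha>" and p: "1 < p"
  obtains M where "0 < M"
    "\<And>(u0 :: 'a::euclidean_space \<Rightarrow> real) u1 \<epsilon> T u R.
      weak_solution \<alpha> p u0 u1 \<epsilon> T u \<Longrightarrow> 1 \<le> R \<Longrightarrow> R\<^sup>2 < T \<Longrightarrow>
      integrable lborel (\<lambda>x. (u0 x + u1 x) * exp (- (1 / R\<^sup>2) * (norm x)\<^sup>2)) \<and>
      \<epsilon> * (LINT x|lborel. (u0 x + u1 x) * exp (- (1 / R\<^sup>2) * (norm x)\<^sup>2))
        \<le> M * R powr (real DIM('a) + (\<alpha> - 2) / (p - 1))"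
proof -
  define p' where "p' = p / (p - 1)"
  define a where "a = \<alpha> / (p - 1)"
  have p': "0 < p'" and a: "0 \<le> a" using p \<alpha> by (auto simp: p'_def a_def)
  obtain M1 where M1: "0 < M1" "\<And>\<tau>. 1 \<le> \<tau> \<Longrightarrow> \<exists>\<eta> w. smooth \<eta> \<and> (\<forall>t\<ge>\<tau>. \<eta> t = 0) \<and> \<eta> 0 = exp (- 1) \<and> deriv \<eta> 0 = 0 \<and>
    (\<forall>t. 0 \<le> \<eta> t \<and> 0 \<le> w t \<and> \<bar>deriv \<eta> t\<bar> \<le> w t / \<tau> * \<eta> t \<and> \<bar>deriv (deriv \<eta>) t\<bar> \<le> w t / \<tau> * \<eta> t \<and>
      \<eta> t * (1 + 2 * w t) powr p' \<le> M1)"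
    by (rule time_cutoff[OF p']) blast
  obtain M2 where M2: "0 < M2" "\<And>R. 0 < R \<Longrightarrow> \<exists>B. \<forall>x::'a. 0 \<le> B x \<and>
    \<bar>laplacian (\<lambda>x. exp (- (1 / R\<^sup>2) * (norm x)\<^sup>2)) x\<bar> \<le> B x / R\<^sup>2 * exp (- (1 / R\<^sup>2) * (norm x)\<^sup>2) \<and>
    exp (- (1 / R\<^sup>2) * (norm x)\<^sup>2) * norm x powr a * (1 + B x) powr p'
      \<le> M2 * R powr a * exp (- (norm x)\<^sup>2 / (2 * R\<^sup>2))"
    by (rule space_cutoff[OF p' a]) blast
  \<comment> \<open>The factor \<open>exp 1\<close> cancels \<eta>(0) = exp (-1), and the last
    factor comes from the Gaussian integral.\<close>
  define M where "M = exp 1 * (M1 * M2 * sqrt (2 * pi) ^ DIM('a))"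
  show thesis
  proof (rule that[of M])
    show "0 < M" using M1 M2 by (simp add: M_def)
    fix u0 u1 :: "'a \<Rightarrow> real" and \<epsilon> T R :: real and u
    assume sol: "weak_solution \<alpha> p u0 u1 \<epsilon> T u" and R: "1 \<le> R" and RT: "R\<^sup>2 < T"
    define \<tau> where "\<tau> = R\<^sup>2"
    define \<phi> where "\<phi> x = exp (- (1 / R\<^sup>2) * (norm x)\<^sup>2)" for x :: 'a
    have \<tau>: "1 \<le> \<tau>" using R by (simp add: \<tau>_def)
    obtain \<eta> w where \<eta>: "smooth \<eta>" "\<And>t. \<tau> \<le> t \<Longrightarrow> \<eta> t = 0" "\<eta> 0 = exp (- 1)" "deriv \<eta> 0 = 0"
      and H: "\<forall>t. 0 \<le> \<eta> t \<and> 0 \<le> w t \<and> \<bar>deriv \<eta> t\<bar> \<le> w t / \<tau> * \<eta> t \<and>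
        \<bar>deriv (deriv \<eta>) t\<bar> \<le> w t / \<tau> * \<eta> t \<and> \<eta> t * (1 + 2 * w t) powr p' \<le> M1"
      using M1(2)[OF \<tau>] by blast
    have \<eta>0: "0 \<le> \<eta> t" and w: "0 \<le> w t"
      and \<eta>1: "\<bar>deriv \<eta> t\<bar> \<le> w t / \<tau> * \<eta> t"
      and \<eta>2: "\<bar>deriv (deriv \<eta>) t\<bar> \<le> w t / \<tau> * \<eta> t"
      and \<eta>M: "\<eta> t * (1 + 2 * w t) powr p' \<le> M1" for t
      using H by blast+
    have \<phi>_eq: "\<phi> = (\<lambda>x. exp (- (1 / R\<^sup>2) * (norm x)\<^sup>2))" by (simp add: fun_eq_iff \<phi>_def)
    have R0: "0 < R" using R by simp
    obtain B where HB: "\<forall>x. 0 \<le> B x \<and> \<bar>laplacian \<phi> x\<bar> \<le> B x / \<tau> * \<phi> x \<and>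
        \<phi> x * norm x powr a * (1 + B x) powr p'
          \<le> M2 * R powr a * exp (- (norm x)\<^sup>2 / (2 * R\<^sup>2))"
      using M2(2)[OF R0] unfolding \<phi>_eq \<tau>_def by blast
    have B: "0 \<le> B x" and \<phi>\<Delta>: "\<bar>laplacian \<phi> x\<bar> \<le> B x / \<tau> * \<phi> x"
      and \<phi>M: "\<phi> x * norm x powr a * (1 + B x) powr p'
        \<le> M2 * R powr a * exp (- (norm x)\<^sup>2 / (2 * R\<^sup>2))" for x
      using HB by blast+
    have \<phi>0: "0 < \<phi> x" for x by (simp add: \<phi>_def)
    define Q where "Q = {0..<T} \<times> (UNIV :: 'a set)"
    define src where "src = (\<lambda>(t, x). norm x powr (- \<alpha>) * \<bar>u t x\<bar> powr p * (\<eta> t * \<phi> x))"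
    define lin where "lin = (\<lambda>(t, x). u t x *
      (deriv (deriv \<eta>) t * \<phi> x - \<eta> t * laplacian \<phi> x - deriv \<eta> t * \<phi> x))"
    have "time_test_function T \<eta>"
      using \<eta> RT unfolding time_test_function_def \<tau>_def by blast
    moreover have "space_test_function \<phi>"
      using space_test_function_gaussian[of R] R unfolding \<phi>_def by simp
    ultimately have "weak_identity \<alpha> p u0 u1 \<epsilon> T u \<eta> \<phi>"
      using sol by (simp add: weak_solution_def)
    then have id: "set_integrable lborel Q src" "set_integrable lborel Q lin"
      "integrable lborel (\<lambda>x. (u0 x + u1 x) * (exp (- 1) * \<phi> x))"
      "(LINT z:Q|lborel. src z) + \<epsilon> * (LINT x|lborel. (u0 x + u1 x) * (exp (- 1) * \<phi> x))
        = (LINT z:Q|lborel. lin z)"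
      unfolding weak_identity_def Let_def Q_def src_def lin_def by (simp_all add: \<eta>(3,4))
    define K where "K = M1 * M2 * R powr a / \<tau> powr p'"
    define E where "E = (\<lambda>(t, x::'a). K * indicator {0..\<tau>} t * exp (- (norm x)\<^sup>2 / (2 * R\<^sup>2)))"
    have K: "0 \<le> K" using M1(1) M2(1) by (simp add: K_def)
    \<comment> \<open>The origin is excluded because \<open>weighted_Young\<close> needs a positive
      base \<open>X = norm x\<close>. \<open>E\<close> majorizes the Young remainder.\<close>
    have pointwise: "lin (t, x) \<le> src (t, x) + E (t, x)" if t: "0 \<le> t" and x: "x \<noteq> 0" for t x
    proof -
      define W where "W = \<eta> t * \<phi> x"
      define G where "G = (1 + 2 * w t) * (1 + B x) / \<tau>"
      have W: "0 \<le> W" using \<eta>0[of t] \<phi>0[of x] by (simp add: W_def)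
      have G: "0 \<le> G" using w[of t] B[of x] \<tau> by (simp add: G_def)
      have "\<bar>deriv (deriv \<eta>) t * \<phi> x - \<eta> t * laplacian \<phi> x - deriv \<eta> t * \<phi> x\<bar>
          \<le> \<bar>deriv (deriv \<eta>) t\<bar> * \<phi> x + \<eta> t * \<bar>laplacian \<phi> x\<bar> + \<bar>deriv \<eta> t\<bar> * \<phi> x"
        using abs_triangle_ineq4[of "deriv (deriv \<eta>) t * \<phi> x - \<eta> t * laplacian \<phi> x" "deriv \<eta> t * \<phi> x"]
          abs_triangle_ineq4[of "deriv (deriv \<eta>) t * \<phi> x" "\<eta> t * laplacian \<phi> x"]
          \<eta>0[of t] \<phi>0[of x] by (simp add: abs_mult)
      also have "\<dots> \<le> w t / \<tau> * \<eta> t * \<phi> x + \<eta> t * (B x / \<tau> * \<phi> x) + w t / \<tau> * \<eta> t * \<phi> x"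
        using \<eta>0[of t] \<phi>0[of x] \<eta>1[of t] \<eta>2[of t] \<phi>\<Delta>[of x]
        by (intro add_mono mult_right_mono mult_left_mono) auto
      also have "\<dots> = W * ((2 * w t + B x) / \<tau>)"
        using \<tau> by (simp add: W_def field_simps)
      \<comment> \<open>The sum 2w + B is enlarged to the product (1 + 2w)(1 + B), so that
        \<open>G powr p'\<close> separates into a time factor and a space factor, matching the two
        cutoff lemmas.\<close>
      also have "\<dots> \<le> W * G"
        unfolding G_def using W w[of t] B[of x] \<tau>
        by (intro mult_left_mono divide_right_mono) (auto simp: algebra_simps)
      finally have L: "\<bar>deriv (deriv \<eta>) t * \<phi> x - \<eta> t * laplacian \<phi> x - deriv \<eta> t * \<phi> x\<bar> \<le> W * G" .
      have "lin (t, x) \<le> \<bar>u t x\<bar> * \<bar>deriv (deriv \<eta>) t * \<phi> x - \<eta> t * laplacian \<phi> x - deriv \<eta> t * \<phi> x\<bar>"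
        unfolding lin_def by (simp add: abs_mult[symmetric])
      also have "\<dots> \<le> \<bar>u t x\<bar> * (W * G)"
        by (intro mult_left_mono L) simp
      also have "\<dots> \<le> src (t, x) + W * norm x powr a * G powr p'"
        using weighted_Young[OF p p'_def, of "norm x" "\<bar>u t x\<bar>" G W \<alpha>] x G W
        by (simp add: src_def W_def a_def)
      also have "W * norm x powr a * G powr p' \<le> E (t, x)"
      proof (cases "t \<le> \<tau>")
        case True
        have "G powr p' = (1 + 2 * w t) powr p' * (1 + B x) powr p' / \<tau> powr p'"
          unfolding G_def using w[of t] B[of x] \<tau> by (simp add: powr_mult powr_divide)
        then have "W * norm x powr a * G powr p'
            = (\<eta> t * (1 + 2 * w t) powr p') * (\<phi> x * norm x powr a * (1 + B x) powr p') / \<tau> powr p'"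
          by (simp add: W_def)
        also have "\<dots> \<le> M1 * (M2 * R powr a * exp (- (norm x)\<^sup>2 / (2 * R\<^sup>2))) / \<tau> powr p'"
          using \<eta>0[of t] \<phi>0[of x] M1(1)
          by (intro divide_right_mono mult_mono \<eta>M \<phi>M) auto
        finally show ?thesis using True t by (simp add: E_def K_def)
      next
        case False
        then show ?thesis using \<eta>(2)[of t] by (simp add: W_def E_def)
      qed
      finally show ?thesis by simp
    qed
    have ind: "integrable lborel (\<lambda>t. K * indicator {0..\<tau>} t)"
      "(LINT t|lborel. K * indicator {0..\<tau>} t) = K * \<tau>"
      using \<tau> by (auto simp: integrable_indicator_iff)
    note gauss = gaussian_integral[of R, where 'a='a, unfolded has_bochner_integral_iff]
    have E: "integrable lborel E" "integral\<^sup>L lborel E = K * \<tau> * (sqrt (2 * pi) * R) ^ DIM('a)"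
      using integral_product_lborel[OF ind(1), of "\<lambda>x::'a. exp (- (norm x)\<^sup>2 / (2 * R\<^sup>2))"] gauss R ind(2)
      unfolding E_def by auto
    \<comment> \<open>All points with x = 0 lie in the hyperplane orthogonal to (0, b), which is a
      null set.\<close>
    obtain b :: 'a where b: "b \<in> Basis" using nonempty_Basis by blast
    then have "(0, b) \<in> (Basis :: (real \<times> 'a) set)" by (simp add: Basis_prod_def)
    then have "AE z in (lborel :: (real \<times> 'a) measure). z \<bullet> (0, b) \<noteq> 0"
      by (rule AE_lborel_inner_neq)
    then have AE: "AE z in lborel. indicator Q z *\<^sub>R lin z \<le> indicator Q z *\<^sub>R src z + E z"
    proof eventually_elim
      case (elim z)
      obtain t x where z: "z = (t, x)" by (cases z)
      with elim have "x \<noteq> 0" by auto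
      moreover have "0 \<le> E z" using K by (simp add: E_def z)
      ultimately show ?case
        using pointwise[of t x] by (cases "z \<in> Q") (auto simp: z Q_def)
    qed
    have "(LINT z:Q|lborel. lin z) \<le> (LINT z|lborel. indicator Q z *\<^sub>R src z + E z)"
      unfolding set_lebesgue_integral_def
      using id(1,2) E(1) AE by (intro integral_mono_AE) (auto simp: set_integrable_def)
    also have "\<dots> = (LINT z:Q|lborel. src z) + K * \<tau> * (sqrt (2 * pi) * R) ^ DIM('a)"
      unfolding set_lebesgue_integral_def E(2)[symmetric]
      using id(1) E(1) by (intro Bochner_Integration.integral_add) (auto simp: set_integrable_def)
    \<comment> \<open>The nonlinear integral occurs with coefficient 1 in the weak identity and in
      this estimate, so it cancels.\<close>
    finally have "\<epsilon> * (LINT x|lborel. (u0 x + u1 x) * (exp (- 1) * \<phi> x))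
        \<le> K * \<tau> * (sqrt (2 * pi) * R) ^ DIM('a)"
      using id(4) by linarith
    moreover have "(LINT x|lborel. (u0 x + u1 x) * (exp (- 1) * \<phi> x))
        = exp (- 1) * (LINT x|lborel. (u0 x + u1 x) * \<phi> x)"
      by (subst Bochner_Integration.integral_mult_right_zero[symmetric]) (simp add: mult_ac)
    ultimately have "exp 1 * (exp (- 1) * (\<epsilon> * (LINT x|lborel. (u0 x + u1 x) * \<phi> x)))
        \<le> exp 1 * (K * \<tau> * (sqrt (2 * pi) * R) ^ DIM('a))"
      by (intro mult_left_mono) (auto simp: mult_ac)
    moreover have "exp 1 * (exp (- 1) * y) = y" for y :: real
      by (simp add: exp_minus)
    ultimately have "\<epsilon> * (LINT x|lborel. (u0 x + u1 x) * \<phi> x)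
        \<le> exp 1 * (K * \<tau> * (sqrt (2 * pi) * R) ^ DIM('a))" by simp
    also have "\<dots> = M * R powr (real DIM('a) + (\<alpha> - 2) / (p - 1))"
    proof -
      have t: "\<tau> = R powr 2" using R0 powr_realpow[of R 2] by (simp add: \<tau>_def)
      have "\<tau> powr p' = R powr (2 * p')" unfolding t by (simp add: powr_powr)
      then have "R powr a / \<tau> powr p' * \<tau> * R ^ DIM('a) = R powr (a - 2 * p' + 2 + real DIM('a))"
        using R0 by (simp add: t powr_add powr_diff powr_realpow)
      also have "a - 2 * p' + 2 + real DIM('a) = real DIM('a) + (\<alpha> - 2) / (p - 1)"
      proof -
        have "p' = 1 + 1 / (p - 1)" using p by (simp add: p'_def field_simps)
        then show ?thesis by (simp add: a_def diff_divide_distrib)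
      qed
      finally have "M * (R powr a / \<tau> powr p' * \<tau> * R ^ DIM('a))
        = M * R powr (real DIM('a) + (\<alpha> - 2) / (p - 1))" by simp
      then show ?thesis by (simp add: M_def K_def power_mult_distrib mult_ac)
    qed
    finally have "\<epsilon> * (LINT x|lborel. (u0 x + u1 x) * \<phi> x)
        \<le> M * R powr (real DIM('a) + (\<alpha> - 2) / (p - 1))" .
    moreover have "integrable lborel (\<lambda>x. (u0 x + u1 x) * \<phi> x)"
    proof -
      have "integrable lborel (\<lambda>x. exp 1 * ((u0 x + u1 x) * (exp (- 1) * \<phi> x)))"
        by (intro integrable_mult_right id(3))
      moreover have "exp 1 * (y * (exp (- 1) * z)) = y * z" for y z :: real
        by (simp add: exp_minus)
      ultimately show ?thesis by simp
    qed
    ultimately show "integrable lborel (\<lambda>x. (u0 x + u1 x) * exp (- (1 / R\<^sup>2) * (norm x)\<^sup>2)) \<and>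
      \<epsilon> * (LINT x|lborel. (u0 x + u1 x) * exp (- (1 / R\<^sup>2) * (norm x)\<^sup>2))
        \<le> M * R powr (real DIM('a) + (\<alpha> - 2) / (p - 1))"
      unfolding \<phi>_def by blast
  qed
qed

lemma slowly_decaying_mass:
  fixes f :: "'a::euclidean_space \<Rightarrow> real" and a c :: real
  assumes a: "0 \<le> a" and c: "0 < c"
    and lower: "AE x in lborel. c * japanese_bracket x powr (- a) * inverse (ln (exp 1 + norm x)) \<le> f x"
  obtains k where "0 < k"
    "\<And>R. 1 \<le> R \<Longrightarrow> integrable lborel (\<lambda>x. f x * exp (- (1 / R\<^sup>2) * (norm x)\<^sup>2)) \<Longrightarrow>
      k * R powr (real DIM('a) - a) / ln (exp 1 + R) \<le> (LINT x|lborel. f x * exp (- (1 / R\<^sup>2) * (norm x)\<^sup>2))"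
proof -
  define V where "V = measure lborel (ball (0::'a) 1)"
  define k where "k = c * 2 powr (- a) * exp (- 1) * V"
  show thesis
  proof (rule that[of k])
    have "0 < V" unfolding V_def by (simp add: content_ball_pos)
    then show "0 < k" using c by (simp add: k_def)
    fix R :: real
    assume R: "1 \<le> R" and int: "integrable lborel (\<lambda>x. f x * exp (- (1 / R\<^sup>2) * (norm x)\<^sup>2))"
    have e1: "1 < exp (1::real)" by simp
    have lnpos: "0 < ln (exp 1 + y)" if "0 \<le> y" for y :: real
      using that e1 by (intro ln_gt_zero) linarith
    define g where "g = c * (2 * R) powr (- a) * inverse (ln (exp 1 + R)) * exp (- 1)"
    have pw: "indicator (ball 0 R) x * g \<le> f x * exp (- (1 / R\<^sup>2) * (norm x)\<^sup>2)"
      if x: "c * japanese_bracket x powr (- a) * inverse (ln (exp 1 + norm x)) \<le> f x" for x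
    proof (cases "norm x < R")
      case True
      have J: "0 < japanese_bracket x" 
        by (simp add: japanese_bracket_def add_pos_nonneg)
      have "japanese_bracket x \<le> 2 * R"
        unfolding japanese_bracket_def
      proof (rule real_le_lsqrt)
        have "(norm x)\<^sup>2 \<le> R\<^sup>2" using True by (intro power_mono) auto
        moreover have "1 \<le> R\<^sup>2" using R by simp
        ultimately show "1 + (norm x)\<^sup>2 \<le> (2 * R)\<^sup>2" by (simp add: power_mult_distrib)
      qed (use R in auto)
      then have "(2 * R) powr (- a) \<le> japanese_bracket x powr (- a)"
        using J a by (intro powr_mono2') auto
      moreover have "inverse (ln (exp 1 + R)) \<le> inverse (ln (exp 1 + norm x))"
        using True lnpos[of "norm x"] e1
        by (intro le_imp_inverse_le) (auto simp: add_pos_nonneg)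
      ultimately have "c * (2 * R) powr (- a) * inverse (ln (exp 1 + R))
          \<le> c * japanese_bracket x powr (- a) * inverse (ln (exp 1 + norm x))"
        using c lnpos[of R] R by (intro mult_mono) auto
      then have le: "c * (2 * R) powr (- a) * inverse (ln (exp 1 + R)) \<le> f x" using x by linarith
      have "(norm x)\<^sup>2 \<le> R\<^sup>2" using True by (intro power_mono) auto
      then have "exp (- 1) \<le> exp (- (1 / R\<^sup>2) * (norm x)\<^sup>2)"
        using R by (simp add: divide_le_eq)
      moreover have nn: "0 \<le> c * (2 * R) powr (- a) * inverse (ln (exp 1 + R))"
        using c lnpos[of R] R by simp
      ultimately have "g \<le> f x * exp (- (1 / R\<^sup>2) * (norm x)\<^sup>2)"
        unfolding g_def using le by (intro mult_mono) auto
      then show ?thesis using True by simp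
    next
      case False
      have "0 \<le> c * japanese_bracket x powr (- a) * inverse (ln (exp 1 + norm x))"
        using c lnpos[of "norm x"] by simp
      then show ?thesis using x False by simp
    qed
    have "k * R powr (real DIM('a) - a) / ln (exp 1 + R) = measure lborel (ball (0::'a) R) * g"
    proof -
      have "measure lborel (ball (0::'a) R) = R powr real DIM('a) * V"
        using content_ball_conv_unit_ball[of R "0::'a"] R by (simp add: V_def powr_realpow)
      moreover have "R powr (real DIM('a) - a) = R powr real DIM('a) * R powr (- a)"
        by (simp add: powr_add[symmetric])
      ultimately show ?thesis
        using R by (simp add: k_def g_def powr_mult divide_inverse)
    qed
    also have "\<dots> = (LINT x|lborel. indicator (ball (0::'a) R) x * g)" by simp
    also have "\<dots> \<le> (LINT x|lborel. f x * exp (- (1 / R\<^sup>2) * (norm x)\<^sup>2))"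
    proof (rule integral_mono_AE)
      show "integrable lborel (\<lambda>x. indicator (ball (0::'a) R) x * g)"
        using emeasure_lborel_ball_finite[of "0::'a" R]
        by (intro integrable_mult_left integrable_real_indicator) (auto simp: less_top)
      show "AE x in lborel. indicator (ball 0 R) x * g \<le> f x * exp (- (1 / R\<^sup>2) * (norm x)\<^sup>2)"
        using lower by eventually_elim (rule pw)
    qed (rule int)
    finally show "k * R powr (real DIM('a) - a) / ln (exp 1 + R)
      \<le> (LINT x|lborel. f x * exp (- (1 / R\<^sup>2) * (norm x)\<^sup>2))" .
  qed
qed

section \<open>Combining upper and lower bounds for the mass of the data\<close>

theorem proposition3p2:
  fixes u0 u1 :: "real ^ 'n \<Rightarrow> real" and \<alpha> \<beta> p c :: real and n :: nat
  assumes n: "n = CARD('n)"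
    and \<alpha>: "0 \<le> \<alpha>" "\<alpha> < 2"
    and \<beta>: "0 \<le> \<beta>" "\<beta> < real n / 2"
    and u0: "u0 \<in> neg_hom_sobolev \<beta>"
    and u1: "u1 \<in> neg_hom_sobolev \<beta>"
    and c: "c > 0"
    and lower: "AE x in lborel. u0 x + u1 x \<ge>
      c * japanese_bracket x powr (- real n * (1 / 2 + \<beta> / real n)) * inverse (ln (exp 1 + norm x))"
    and p: "1 < p" "p < p_crit \<alpha> \<beta> n"
  shows "\<exists>\<epsilon>2 > 0. \<exists>C > 0. \<forall>\<epsilon>. 0 < \<epsilon> \<and> \<epsilon> \<le> \<epsilon>2 \<longrightarrow>
    lifespan \<alpha> p u0 u1 \<epsilon> \<le> ennreal (C *
      \<epsilon> powr (- (4 * (p - 1) / (4 - 2 * \<alpha> - (real n + 2 * \<beta>) * (p - 1)))) *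
      ln (inverse \<epsilon>) powr (4 * (p - 1) / (4 - 2 * \<alpha> - (real n + 2 * \<beta>) * (p - 1))))"
proof -
  \<comment> \<open>Subcriticality says exactly that the denominator is positive. The final
    inequality bounds R^(2/K), so R^2 is controlled by the K-th power of that bound.\<close>
  define K where "K = 4 * (p - 1) / (4 - 2 * \<alpha> - (real n + 2 * \<beta>) * (p - 1))"
  define a where "a = real n / 2 + \<beta>"
  have n0: "0 < real n" using n by simp
  have a: "0 \<le> a" using \<beta> by (simp add: a_def)
  have "p - 1 < (4 - 2 * \<alpha>) / (real n + 2 * \<beta>)" using p(2) by (simp add: p_crit_def)
  moreover have n\<beta>: "0 < real n + 2 * \<beta>" using n0 \<beta>(1) by linarith
  ultimately have den: "0 < 4 - 2 * \<alpha> - (real n + 2 * \<beta>) * (p - 1)"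
    by (simp add: field_simps)
  then have K: "0 < K" using p(1) by (simp add: K_def)
  have "- real n * (1 / 2 + \<beta> / real n) = - a" using n0 by (simp add: a_def field_simps)
  with lower have lower': "AE x in lborel. c * japanese_bracket x powr (- a) * inverse (ln (exp 1 + norm x)) \<le> u0 x + u1 x"
    by simp
  obtain k where k: "0 < k"
    "\<And>R. 1 \<le> R \<Longrightarrow> integrable lborel (\<lambda>x. (u0 x + u1 x) * exp (- (1 / R\<^sup>2) * (norm x)\<^sup>2)) \<Longrightarrow>
      k * R powr (real DIM(real ^ 'n) - a) / ln (exp 1 + R)
        \<le> (LINT x|lborel. (u0 x + u1 x) * exp (- (1 / R\<^sup>2) * (norm x)\<^sup>2))"
    using slowly_decaying_mass[OF a c lower'] by blast
  obtain M where M: "0 < M"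
    "\<And>(u0 :: real ^ 'n \<Rightarrow> real) u1 \<epsilon> T u R.
      weak_solution \<alpha> p u0 u1 \<epsilon> T u \<Longrightarrow> 1 \<le> R \<Longrightarrow> R\<^sup>2 < T \<Longrightarrow>
      integrable lborel (\<lambda>x. (u0 x + u1 x) * exp (- (1 / R\<^sup>2) * (norm x)\<^sup>2)) \<and>
      \<epsilon> * (LINT x|lborel. (u0 x + u1 x) * exp (- (1 / R\<^sup>2) * (norm x)\<^sup>2))
        \<le> M * R powr (real DIM(real ^ 'n) + (\<alpha> - 2) / (p - 1))"
    using weak_solution_test_bound[OF \<alpha>(1) p(1)] by blast
  obtain C where C: "1 \<le> C"
    "\<And>\<epsilon> R. 0 < \<epsilon> \<Longrightarrow> \<epsilon> \<le> exp (- 1) \<Longrightarrow> 1 \<le> R \<Longrightarrow> \<epsilon> * R powr (2 / K) \<le> M / k * ln (exp 1 + R) \<Longrightarrow>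
      R powr (2 / K) \<le> C * (ln (inverse \<epsilon>) / \<epsilon>)"
    using lifespan_inequality_inversion[of "M / k" "2 / K"] M(1) k(1) K by auto
  \<comment> \<open>The powers of \<open>R\<close> in the upper and the lower bound for the mass
    differ by 2/K.\<close>
  have exponent: "real DIM(real ^ 'n) + (\<alpha> - 2) / (p - 1) = real DIM(real ^ 'n) - a - 2 / K"
    using p(1) den by (simp add: K_def a_def n field_simps)
  have bound: "T \<le> C powr K * \<epsilon> powr (- K) * ln (inverse \<epsilon>) powr K"
    if \<epsilon>: "0 < \<epsilon>" "\<epsilon> \<le> exp (- 1)" and T: "0 < T" "unique_weak_solution_exists \<alpha> p u0 u1 \<epsilon> T" for \<epsilon> T
  proof -
    obtain u where u: "weak_solution \<alpha> p u0 u1 \<epsilon> T u"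
      using T(2) by (auto simp: unique_weak_solution_exists_def)
    have "ln \<epsilon> \<le> ln (exp (- 1))" using \<epsilon> by (subst ln_le_cancel_iff) auto
    then have L: "1 \<le> ln (inverse \<epsilon>)" using \<epsilon>(1) by (simp add: ln_inverse)
    have "exp (- 1) < (1 :: real)" by simp
    then have \<epsilon>1: "\<epsilon> \<le> 1" using \<epsilon>(2) by linarith
    define Z where "Z = C * (ln (inverse \<epsilon>) / \<epsilon>)"
    have "1 \<le> ln (inverse \<epsilon>) / \<epsilon>" using L \<epsilon>(1) \<epsilon>1 by (simp add: le_divide_eq)
    then have "1 * 1 \<le> Z" unfolding Z_def using C(1) by (intro mult_mono) auto
    then have Z: "1 \<le> Z" by simp
    have tau: "R\<^sup>2 \<le> Z powr K" if R: "1 \<le> R" "R\<^sup>2 < T" for R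
    proof -
      note mass = M(2)[OF u R]
      have ln: "0 < ln (exp 1 + R)" using R(1) one_less_exp_iff[of "1::real"] by (intro ln_gt_zero) linarith
      have "\<epsilon> * (k * R powr (real DIM(real ^ 'n) - a) / ln (exp 1 + R))
          \<le> \<epsilon> * (LINT x|lborel. (u0 x + u1 x) * exp (- (1 / R\<^sup>2) * (norm x)\<^sup>2))"
        using \<epsilon>(1) k(2)[OF R(1)] mass by (intro mult_left_mono) auto
      also have "\<dots> \<le> M * R powr (real DIM(real ^ 'n) + (\<alpha> - 2) / (p - 1))"
        using mass by blast
      also have "\<dots> = M * (R powr (real DIM(real ^ 'n) - a) / R powr (2 / K))"
        unfolding powr_diff[symmetric] exponent ..
      finally have "\<epsilon> * R powr (2 / K) \<le> M / k * ln (exp 1 + R)"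
        using ln k(1) R(1) by (simp add: field_simps)
      then have "R powr (2 / K) \<le> Z"
        unfolding Z_def using C(2) \<epsilon> R(1) by blast
      then have "(R powr (2 / K)) powr K \<le> Z powr K"
        using K by (intro powr_mono2) auto
      also have "(R powr (2 / K)) powr K = R\<^sup>2"
        using K R(1) powr_realpow[of R 2] by (simp add: powr_powr)
      finally show ?thesis .
    qed
    have "T \<le> Z powr K"
    \<comment> \<open>For T \<le> 1 no radius R \<ge> 1 satisfies R^2 < T, and
      \<open>1 \<le> Z\<close> gives the bound directly. Otherwise R^2 is taken above the claimed
      bound but below \<open>T\<close>, which contradicts \<open>tau\<close>.\<close>
    proof (cases "T \<le> 1")
      case True
      then show ?thesis using ge_one_powr_ge_zero[of Z K] Z K by linarith
    next
      case False
      show ?thesis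
      proof (rule field_le_epsilon, rule ccontr)
        fix e :: real assume e: "0 < e" and "\<not> T \<le> Z powr K + e"
        then have "1 \<le> sqrt (Z powr K + e)" "(sqrt (Z powr K + e))\<^sup>2 < T"
          using ge_one_powr_ge_zero[of Z K] Z K by auto
        then have "(sqrt (Z powr K + e))\<^sup>2 \<le> Z powr K" by (rule tau)
        then show False using e by simp
      qed
    qed
    also have "Z powr K = C powr K * \<epsilon> powr (- K) * ln (inverse \<epsilon>) powr K"
      unfolding Z_def using C(1) L \<epsilon>(1) by (simp add: powr_mult powr_divide powr_minus_divide)
    finally show ?thesis .
  qed
  show ?thesis
    unfolding K_def[symmetric]
  \<comment> \<open>The threshold exp (-1) ensures ln (1/\<epsilon>) \<ge> 1.\<close>
  proof (rule exI[of _ "exp (- 1)"], intro exI[of _ "C powr K"] conjI allI impI)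
    show "0 < C powr K" using C(1) by simp
    fix \<epsilon> :: real assume "0 < \<epsilon> \<and> \<epsilon> \<le> exp (- 1)"
    then show "lifespan \<alpha> p u0 u1 \<epsilon> \<le> ennreal (C powr K * \<epsilon> powr (- K) * ln (inverse \<epsilon>) powr K)"
      unfolding lifespan_def using bound by (intro SUP_least) (auto intro!: ennreal_leI)
  qed simp
qed

end
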